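(* Let $T\in\mathcal T_h^\Gamma$ and let $(\mathbf u_h^J,p_h^J)|_T\in(\boldsymbol P_1(\cup T_h^\pm),P_1(\cup T_h^\pm))$ be the correction function, i.e. the function satisfying $\mathbf u_h^J(\mathbf a_{i,T})=\mathbf 0$, $p_h^J(\mathbf a_{i,T})=0$ at all vertices $\mathbf a_{i,T}$, $i=1,\dots,N+1$, of $T$ and $$[\sigma(\mu_h,\mathbf u_h^J,p_h^J)\mathbf n_h]_{\Gamma_{h,T}}=\mathrm{avg}_{\Gamma_{R_T}}(\mathbf g),\quad[\mathbf u_h^J]_{\Gamma_{h,T}}=\mathbf 0,\quad[\nabla\cdot\mathbf u_h^J]_{\Gamma_{h,T}}=0,\quad[\nabla p_h^J]_{\Gamma_{h,T}}=\mathbf 0.$$ Then $$\mathbf u_h^J|_T=\sum_{i=1}^{N-1}\frac{\mathbf t_{i,h}^T\,\mathrm{avg}_{\Gamma_{R_T}}(\mathbf g)\,(w_T-I_{h,T}w_T)\,\mathbf t_{i,h}}{\mu^+\big(1+(\mu^-/\mu^+-1)\nabla I_{h,T}w_T\cdot\mathbf n_h\big)},\qquad p_h^J|_T=(z_T-I_{h,T}z_T)\,\mathbf n_h^T\,\mathrm{avg}_{\Gamma_{R_T}}(\mathbf g).$$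
   Context: Setting. $N\in\{2,3\}$; $\Omega\subset\mathbb R^N$ is an open rectangle ($N=2$) or cuboid ($N=3$); $\Gamma\subset\Omega$ is a closed $C^2$ hypersurface dividing $\Omega$ into $\Omega^-$ (the inclusion, $\partial\Omega^-=\Gamma$) and $\Omega^+$; $\mu^\pm>0$ are constants; $\mathbf g\in L^2(\Gamma)^N$. $d$ is the signed distance, $d=\pm\mathrm{dist}(\cdot,\Gamma)$ in $\Omega^\pm$. $\{\mathcal T_h\}$ is a shape-regular family of Cartesian simplicial meshes of $\Omega$, not fitted to $\Gamma$: $\Omega$ is divided into rectangles/cuboids by a tensor-product grid; for $N=2$ each rectangle is split into two triangles by a diagonal, for $N=3$ each cuboid is split into six tetrahedra sharing a space diagonal (Kuhn subdivision), in the same manner in every cell. Elements are open; $\mathcal T_h^\Gamma=\{T\in\mathcal T_h:T\cap\Gamma\neq\emptyset\}$; $h_T=\mathrm{diam}(T)$ and $h=\max_Th_T$ is smaller than a fixed threshold (so that the interface is resolved). $I_h$ is continuous piecewise linear nodal interpolation, $I_{h,T}$ linear nodal interpolation on $T$. $\Gamma_h=\{I_hd=0\}$, $\Omega_h^\pm=\{\pm I_hd>0\}$, $T_h^\pm=T\cap\Omega_h^\pm$, $\mu_h|_{\Omega_h^\pm}=\mu^\pm$. For $T\in\mathcal T_h^\Gamma$: $\Gamma_{h,T}=\Gamma_h\cap T$ (assumed nonempty), $\Gamma_{h,T}^{ext}$ is the hyperplane containing it, $\mathbf n_h$ is the unit normal to it pointing from $\Omega_h^-$ to $\Omega_h^+$,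 $\mathbf t_{1,h},\dots,\mathbf t_{N-1,h}$ are unit tangent vectors forming with $\mathbf n_h$ an orthonormal basis, $\mathbf x_T^*$ is a fixed point of $\Gamma_{h,T}$; $[v]_{\Gamma_{h,T}}$ is the value from $\Omega_h^+$ minus that from $\Omega_h^-$. Vertex values of functions discontinuous across $\Gamma_h$ at a vertex on $\Gamma_h$ are taken from the minus side. $\sigma(\mu,\mathbf v,q)=\mu(\nabla\mathbf v+(\nabla\mathbf v)^T)-q\mathbb I$. $P_1(\cup T_h^\pm)$ is the set of functions on $T$ whose restrictions to $T_h^+$ and $T_h^-$ are polynomials of degree $\le1$, $\boldsymbol P_1(\cup T_h^\pm)=P_1(\cup T_h^\pm)^N$. $R_T=\{\mathbf x_T^*+\xi_N\mathbf n_h+\sum_{i=1}^{N-1}\xi_i\mathbf t_{i,h}:|\xi_i|\le h_T,\ i=1,\dots,N\}$, $\Gamma_{R_T}=\Gamma\cap R_T$, $\mathrm{avg}_{\Gamma_{R_T}}(\mathbf g)=|\Gamma_{R_T}|^{-1}\int_{\Gamma_{R_T}}\mathbf g$. The functions $z_T,w_T$ on $T$: $z_T=-1$ on $T_h^+$, $z_T=0$ on $T_h^-$; $w_T(\mathbf x)=\mathrm{dist}(\mathbf x,\Gamma_{h,T}^{ext})$ on $T_h^+$, $w_T=0$ on $T_h^-$. *)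

theory Defs
  imports "HOL-Analysis.Analysis"
begin

section \<open>Surface measure\<close>

definition hausdorff_premeasure :: "nat \<Rightarrow> real \<Rightarrow> 'a::metric_space set \<Rightarrow> ennreal" where
  "hausdorff_premeasure s \<delta> A =
     (INF C \<in> {C :: nat \<Rightarrow> 'a set. A \<subseteq> (\<Union>i. C i) \<and> (\<forall>i. bounded (C i) \<and> diameter (C i) \<le> \<delta>)}.
        \<Sum>i. ennreal (if C i = {} then 0
                     else unit_ball_vol (real s) * (diameter (C i) / 2) ^ s))"

definition hausdorff_outer :: "nat \<Rightarrow> 'a::metric_space set \<Rightarrow> ennreal" where
  "hausdorff_outer s A = (SUP \<delta> \<in> {0<..}. hausdorff_premeasure s \<delta> A)"

text \<open>The surface measure on hypersurfaces of \<open>N\<close>-space is the \<open>(N - 1)\<close>-dimensional Hausdorff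
  measure on the Borel sets, normalised so that it agrees with Lebesgue measure on hyperplanes.
  Hausdorff outer measure is a metric outer measure, hence countably additive on Borel sets, so
  \<open>measure_of\<close> does not fall back to the zero measure here.\<close>

definition surface_measure :: "(real^'n) measure" where
  "surface_measure = measure_of UNIV (sets borel) (hausdorff_outer (CARD('n) - 1))"

definition surface_avg :: "(real^'n) set \<Rightarrow> (real^'n \<Rightarrow> real^'n) \<Rightarrow> real^'n" where
  "surface_avg S g = (1 / measure surface_measure S) *\<^sub>R (LINT x:S|surface_measure. g x)"

definition L2_surface :: "(real^'n) set \<Rightarrow> (real^'n \<Rightarrow> real^'n) \<Rightarrow> bool" where
  "L2_surface \<Gamma> g \<longleftrightarrow>
     g \<in> borel_measurable (restrict_space surface_measure \<Gamma>) \<and>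
     integrable (restrict_space surface_measure \<Gamma>) (\<lambda>x. (norm (g x))\<^sup>2)"


section \<open>Interface and signed distance\<close>

text \<open>\<open>G\<close> and \<open>H\<close> are the gradient and the Hessian of \<open>\<phi>\<close>.\<close>

definition C2_with_gradient ::
  "(real^'n) set \<Rightarrow> (real^'n \<Rightarrow> real) \<Rightarrow> (real^'n \<Rightarrow> real^'n) \<Rightarrow> bool" where
  "C2_with_gradient U \<phi> G \<longleftrightarrow>
     (\<exists>H :: real^'n \<Rightarrow> real^'n^'n.
        (\<forall>x\<in>U. GDERIV \<phi> x :> G x \<and> (G has_derivative (\<lambda>v. H x *v v)) (at x)) \<and>
        continuous_on U H)"

definition closed_C2_hypersurface :: "(real^'n) set \<Rightarrow> bool" where
  "closed_C2_hypersurface \<Gamma> \<longleftrightarrow>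
     compact \<Gamma> \<and> \<Gamma> \<noteq> {} \<and>
     (\<forall>x\<in>\<Gamma>. \<exists>U \<phi> G. open U \<and> x \<in> U \<and> C2_with_gradient U \<phi> G \<and>
        (\<forall>y\<in>U. G y \<noteq> 0) \<and> \<Gamma> \<inter> U = {y\<in>U. \<phi> y = 0})"

text \<open>\<open>\<Omega>m\<close> is the inclusion. The last conjunct excludes that \<open>\<Omega>m\<close> lies on both sides of some
  part of \<open>\<Gamma>\<close>.\<close>

definition divides_domain ::
  "(real^'n) set \<Rightarrow> (real^'n) set \<Rightarrow> (real^'n) set \<Rightarrow> (real^'n) set \<Rightarrow> bool" where
  "divides_domain \<Gamma> \<Omega> \<Omega>m \<Omega>p \<longleftrightarrow>
     \<Gamma> \<subseteq> \<Omega> \<and> open \<Omega>m \<and> open \<Omega>p \<and> \<Omega>m \<noteq> {} \<and> \<Omega>p \<noteq> {} \<and> \<Omega>m \<inter> \<Omega>p = {} \<and>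
     \<Omega>m \<union> \<Omega>p = \<Omega> - \<Gamma> \<and> frontier \<Omega>m = \<Gamma> \<and> \<Gamma> \<subseteq> frontier \<Omega>p"

definition signed_distance :: "(real^'n) set \<Rightarrow> (real^'n) set \<Rightarrow> real^'n \<Rightarrow> real" where
  "signed_distance \<Gamma> \<Omega>m x = (if x \<in> \<Omega>m then - infdist x \<Gamma> else infdist x \<Gamma>)"


section \<open>Cartesian simplicial meshes\<close>

text \<open>A mesh is represented by the set of the vertex sets of its elements.\<close>

definition element :: "(real^'n) set \<Rightarrow> (real^'n) set" where
  "element V = interior (convex hull V)"

text \<open>The corner of the cell \<open>cbox lo hi\<close> that is reached from the corner determined by \<open>S\<close>
  (upper value exactly in the directions in \<open>S\<close>) by moving along the edges in the directions
  in \<open>A\<close>.\<close>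

definition cell_corner :: "real^'n \<Rightarrow> real^'n \<Rightarrow> 'n set \<Rightarrow> 'n set \<Rightarrow> real^'n" where
  "cell_corner lo hi S A = (\<chi> i. if (i \<in> A) = (i \<in> S) then lo $ i else hi $ i)"

text \<open>Kuhn simplex: walk from the corner given by \<open>S\<close> to the opposite one, along the edges in
  the order given by the permutation \<open>\<pi>\<close>. All permutations together yield two triangles (six
  tetrahedra) sharing the diagonal through the corner given by \<open>S\<close>.\<close>

definition kuhn_simplex :: "real^'n \<Rightarrow> real^'n \<Rightarrow> 'n set \<Rightarrow> (nat \<Rightarrow> 'n) \<Rightarrow> (real^'n) set" where
  "kuhn_simplex lo hi S \<pi> = (\<lambda>k. cell_corner lo hi S (\<pi> ` {..<k})) ` {..CARD('n)}"

text \<open>\<open>X i 0 < \<dots> < X i (K i)\<close> are the grid points in direction \<open>i\<close>; the diagonal direction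
  \<open>S\<close> is the same in all cells.\<close>

definition cartesian_mesh :: "real^'n \<Rightarrow> real^'n \<Rightarrow> (real^'n) set set \<Rightarrow> bool" where
  "cartesian_mesh a b \<T> \<longleftrightarrow>
     (\<exists>(K :: 'n \<Rightarrow> nat) (X :: 'n \<Rightarrow> nat \<Rightarrow> real) (S :: 'n set).
        (\<forall>i. K i \<ge> 1 \<and> strict_mono_on {..K i} (X i) \<and> X i 0 = a $ i \<and> X i (K i) = b $ i) \<and>
        \<T> = {kuhn_simplex (\<chi> i. X i (m i)) (\<chi> i. X i (Suc (m i))) S \<pi> | m \<pi>.
               (\<forall>i. m i < K i) \<and> bij_betw \<pi> {..<CARD('n)} UNIV})"

definition mesh_size :: "(real^'n) set set \<Rightarrow> real" where
  "mesh_size \<T> = Max ((\<lambda>V. diameter (element V)) ` \<T>)"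

definition shape_regular :: "(real^'n) set set set \<Rightarrow> bool" where
  "shape_regular \<F> \<longleftrightarrow>
     (\<exists>\<kappa>. \<forall>\<T>\<in>\<F>. \<forall>V\<in>\<T>. \<exists>c r. r > 0 \<and> ball c r \<subseteq> element V \<and> diameter (element V) \<le> \<kappa> * r)"


section \<open>Piecewise linear functions and interpolation\<close>

definition P1_on :: "(real^'n) set \<Rightarrow> (real^'n \<Rightarrow> real) \<Rightarrow> bool" where
  "P1_on A v \<longleftrightarrow> (\<exists>c \<beta>. \<forall>x\<in>A. v x = c \<bullet> x + \<beta>)"

text \<open>The local interpolant is the polynomial itself, defined on the whole space.\<close>

definition simplex_interp :: "(real^'n) set \<Rightarrow> (real^'n \<Rightarrow> real) \<Rightarrow> real^'n \<Rightarrow> real" where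
  "simplex_interp V f = (THE l. P1_on UNIV l \<and> (\<forall>a\<in>V. l a = f a))"

text \<open>The meshes are conforming, so the value does not depend on which of the closed elements
  containing \<open>x\<close> is chosen.\<close>

definition mesh_interp :: "(real^'n) set set \<Rightarrow> (real^'n \<Rightarrow> real) \<Rightarrow> real^'n \<Rightarrow> real" where
  "mesh_interp \<T> f x = simplex_interp (SOME V. V \<in> \<T> \<and> x \<in> convex hull V) f x"

definition discrete_plus ::
  "(real^'n) set \<Rightarrow> (real^'n) set set \<Rightarrow> (real^'n \<Rightarrow> real) \<Rightarrow> (real^'n) set" where
  "discrete_plus \<Omega> \<T> d = {x \<in> closure \<Omega>. mesh_interp \<T> d x > 0}"

definition discrete_minus ::
  "(real^'n) set \<Rightarrow> (real^'n) set set \<Rightarrow> (real^'n \<Rightarrow> real) \<Rightarrow> (real^'n) set" where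
  "discrete_minus \<Omega> \<T> d = {x \<in> closure \<Omega>. mesh_interp \<T> d x < 0}"

definition discrete_interface ::
  "(real^'n) set \<Rightarrow> (real^'n) set set \<Rightarrow> (real^'n \<Rightarrow> real) \<Rightarrow> (real^'n) set" where
  "discrete_interface \<Omega> \<T> d = {x \<in> closure \<Omega>. mesh_interp \<T> d x = 0}"


section \<open>Differential operators, traces and jumps\<close>

definition grad :: "(real^'n \<Rightarrow> real) \<Rightarrow> real^'n \<Rightarrow> real^'n" where
  "grad f x = (\<chi> i. frechet_derivative f (at x) (axis i 1))"

definition divergence :: "(real^'n \<Rightarrow> real^'n) \<Rightarrow> real^'n \<Rightarrow> real" where
  "divergence v x = trace (jacobian v (at x))"

definition stress ::
  "real \<Rightarrow> (real^'n \<Rightarrow> real^'n) \<Rightarrow> (real^'n \<Rightarrow> real) \<Rightarrow> real^'n \<Rightarrow> real^'n^'n" where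
  "stress \<mu> v q x = \<mu> *\<^sub>R (jacobian v (at x) + transpose (jacobian v (at x))) - q x *\<^sub>R mat 1"

definition jump ::
  "(real^'n) set \<Rightarrow> (real^'n) set \<Rightarrow> (real^'n \<Rightarrow> 'b::real_normed_vector) \<Rightarrow> real^'n \<Rightarrow> 'b" where
  "jump Tp Tm v x = Lim (at x within Tp) v - Lim (at x within Tm) v"

text \<open>Value at a vertex \<open>a\<close> of a function given on the two parts \<open>Tp\<close>, \<open>Tm\<close> of the open element:
  vertices on the discrete interface take the value from the minus side.\<close>

definition vertex_value ::
  "(real^'n) set \<Rightarrow> (real^'n) set \<Rightarrow> (real^'n) set \<Rightarrow> (real^'n \<Rightarrow> 'b::real_normed_vector) \<Rightarrow> real^'n \<Rightarrow> 'b"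
  where
  "vertex_value \<Omega>hp Tp Tm v a =
     (if a \<in> \<Omega>hp then Lim (at a within Tp) v else Lim (at a within Tm) v)"


section \<open>Local geometry on an interface element and the correction function\<close>

text \<open>\<open>H\<close> is the hyperplane containing \<open>\<Gamma>T\<close>, \<open>n\<close> its unit normal pointing from
  \<open>\<Omega>hm\<close> to \<open>\<Omega>hp\<close>, and \<open>t 1, \<dots>, t (N - 1)\<close> are the tangents.\<close>

definition interface_frame ::
  "(real^'n) set \<Rightarrow> (real^'n) set \<Rightarrow> (real^'n) set \<Rightarrow> (real^'n) set \<Rightarrow> real^'n \<Rightarrow> (nat \<Rightarrow> real^'n) \<Rightarrow> bool"
  where
  "interface_frame \<Gamma>T \<Omega>hp \<Omega>hm H n t \<longleftrightarrow>
     (\<exists>c \<beta>. c \<noteq> 0 \<and> H = {x. c \<bullet> x = \<beta>}) \<and> \<Gamma>T \<subseteq> H \<and>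
     norm n = 1 \<and> (\<forall>x\<in>H. \<forall>y\<in>H. n \<bullet> (x - y) = 0) \<and>
     (\<forall>x\<in>\<Gamma>T. \<forall>\<^sub>F s in at_right 0. x + s *\<^sub>R n \<in> \<Omega>hp \<and> x - s *\<^sub>R n \<in> \<Omega>hm) \<and>
     (\<forall>i\<in>{1..CARD('n) - 1}. norm (t i) = 1 \<and> t i \<bullet> n = 0) \<and>
     (\<forall>i\<in>{1..CARD('n) - 1}. \<forall>j\<in>{1..CARD('n) - 1}. i \<noteq> j \<longrightarrow> t i \<bullet> t j = 0)"

definition local_cube ::
  "real \<Rightarrow> real^'n \<Rightarrow> real^'n \<Rightarrow> (nat \<Rightarrow> real^'n) \<Rightarrow> (real^'n) set" where
  "local_cube r xs n t =
     {xs + \<xi> (CARD('n)) *\<^sub>R n + (\<Sum>i\<in>{1..CARD('n) - 1}. \<xi> i *\<^sub>R t i) | \<xi> :: nat \<Rightarrow> real.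
        \<forall>i\<in>{1..CARD('n)}. \<bar>\<xi> i\<bar> \<le> r}"

definition z_fun :: "(real^'n) set \<Rightarrow> real^'n \<Rightarrow> real" where
  "z_fun Tp x = (if x \<in> Tp then -1 else 0)"

definition w_fun :: "(real^'n) set \<Rightarrow> (real^'n) set \<Rightarrow> real^'n \<Rightarrow> real" where
  "w_fun H Tp x = (if x \<in> Tp then infdist x H else 0)"

definition correction_function ::
  "real \<Rightarrow> real \<Rightarrow> (real^'n) set \<Rightarrow> (real^'n) set \<Rightarrow> (real^'n) set \<Rightarrow> (real^'n) set \<Rightarrow>
   real^'n \<Rightarrow> real^'n \<Rightarrow> (real^'n \<Rightarrow> real^'n) \<Rightarrow> (real^'n \<Rightarrow> real) \<Rightarrow> bool"
  where
  "correction_function \<mu>p \<mu>m V \<Gamma>T \<Omega>hp \<Omega>hm n gavg u p \<longleftrightarrow>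
     (let Tp = element V \<inter> \<Omega>hp; Tm = element V \<inter> \<Omega>hm;
          \<mu>h = (\<lambda>x. if x \<in> \<Omega>hp then \<mu>p else \<mu>m)
      in
        (\<forall>i. P1_on Tp (\<lambda>x. u x $ i) \<and> P1_on Tm (\<lambda>x. u x $ i)) \<and> P1_on Tp p \<and> P1_on Tm p \<and>
        (\<forall>a\<in>V. vertex_value \<Omega>hp Tp Tm u a = 0 \<and> vertex_value \<Omega>hp Tp Tm p a = 0) \<and>
        (\<forall>x\<in>\<Gamma>T.
           jump Tp Tm (\<lambda>y. stress (\<mu>h y) u p y *v n) x = gavg \<and>
           jump Tp Tm u x = 0 \<and>
           jump Tp Tm (divergence u) x = 0 \<and>
           jump Tp Tm (grad p) x = 0))"

end

(* On an interface element let l be the affine interpolant of the signed distance. It is a positive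
   multiple of L(x) = n . (x - xs). Continuity across {L = 0} and the divergence condition force
   u = u^- + max(0,L) d with u^- affine and d . n = 0, and the condition on grad p forces p to be affine
   plus a multiple of z. Vanishing at the vertices then gives u = d (w - I w) and p = -q (z - I z), and
   the stress condition reads avg g = (mu^+ (1 - kappa) + mu^- kappa) d - q n with
   kappa = grad (I w) . n. This can be solved for d and q because 0 <= kappa <= 1, which holds on Kuhn
   simplices since they contain an edge parallel to each axis. *)

theory Submission
  imports Defs
begin

section \<open>Kuhn simplices\<close>

text \<open>The delicate point is solvability for every contrast. The factor of \<open>d\<close> is
  \<open>\<mu>p * (1 - \<kappa>) + \<mu>m * \<kappa>\<close>; on an obtuse simplex the interpolant
  of \<open>max 0 L\<close> can have slope \<kappa> outside [0,1], and then some ratio of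
  viscosities makes the factor vanish. Axis-parallel edges split \<kappa> into one product per
  coordinate, each controlled by one edge. The stress yields a scalar multiple of \<open>d\<close>
  because the two gradients have rank one, \<open>d (n - k)^T\<close> and \<open>- d k^T\<close>
  with \<open>k = grad (I w)\<close>, and \<open>d . n = 0\<close> annihilates their transposes on
  \<open>n\<close>. The other obstacle is that the discrete subdomains come from a global
  interpolant that picks an arbitrary closed element containing the point. To describe them on one
  element and at its vertices by a single affine function, a closed element must not meet the
  interior of another one, and must contain no mesh vertex besides its own. Both are seen in
  coordinates scaled to the unit cube, where the points of a Kuhn simplex have coordinates
  decreasing in the order given by \<pi>.\<close>

locale kuhn =
  fixes lo hi :: "real^'n" and S :: "'n set" and \<pi> :: "nat \<Rightarrow> 'n"
  assumes lo_less_hi: "lo $ i < hi $ i"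
    and bij: "bij_betw \<pi> {..<CARD('n)} UNIV"
begin

definition path :: "nat \<Rightarrow> real^'n" where
  "path k = cell_corner lo hi S (\<pi> ` {..<k})"

text \<open>The step is signed: a direction in \<open>S\<close> starts at its upper value and is
  walked downwards.\<close>

definition len :: "'n \<Rightarrow> real" where
  "len i = (if i \<in> S then lo $ i - hi $ i else hi $ i - lo $ i)"

text \<open>Scaling by the signed step sends the start of the walk to 0 and its end to 1 in every
  direction, so that the choice of the diagonal disappears from the order arguments.\<close>

definition coord :: "real^'n \<Rightarrow> 'n \<Rightarrow> real" where
  "coord y i = (y $ i - path 0 $ i) / len i"

abbreviation V :: "(real^'n) set" where
  "V \<equiv> kuhn_simplex lo hi S \<pi>"

lemma V_eq: "V = path ` {..CARD('n)}"
  by (simp add: kuhn_simplex_def path_def)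

lemma len_nonzero [simp]: "len i \<noteq> 0"
  using lo_less_hi[of i] by (simp add: len_def)

lemma index: obtains k where "k < CARD('n)" "i = \<pi> k"
  using bij unfolding bij_betw_def by (metis UNIV_I imageE lessThan_iff)

lemma inj_index: "j < CARD('n) \<Longrightarrow> k < CARD('n) \<Longrightarrow> \<pi> j = \<pi> k \<longleftrightarrow> j = k"
  using bij unfolding bij_betw_def inj_on_def by blast

lemma index_in_image:
  assumes "j < CARD('n)" "k \<le> CARD('n)"
  shows "\<pi> j \<in> \<pi> ` {..<k} \<longleftrightarrow> j < k"
proof -
  have "\<pi> j = \<pi> i \<longleftrightarrow> j = i" if "i < k" for i
    using inj_index assms that by simp
  then show ?thesis by auto
qed

lemma path_nth: "path k $ i = path 0 $ i + (if i \<in> \<pi> ` {..<k} then len i else 0)"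
  by (simp add: path_def cell_corner_def len_def)

lemma path_Suc:
  assumes "k < CARD('n)"
  shows "path (Suc k) = path k + axis (\<pi> k) (len (\<pi> k))"
proof -
  have "\<pi> k \<notin> \<pi> ` {..<k}"
    using index_in_image[of k k] assms by simp
  then show ?thesis
    by (auto simp: vec_eq_iff path_nth[of "Suc k"] path_nth[of k] axis_def lessThan_Suc)
qed

lemma inner_path_Suc:
  assumes "k < CARD('n)"
  shows "c \<bullet> path (Suc k) = c \<bullet> path k + c $ \<pi> k * len (\<pi> k)"
  by (simp add: path_Suc[OF assms] inner_add_right inner_axis)

text \<open>The walk uses every direction once, so for each axis some pair of consecutive vertices
  isolates a single component of any linear functional.\<close>

lemma edge:
  obtains v v' where "v \<in> V" "v' \<in> V" "\<And>c. c \<bullet> v' = c \<bullet> v + c $ i * len i"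
proof -
  obtain k where k: "k < CARD('n)" "i = \<pi> k" by (rule index)
  show thesis
    by (rule that[of "path k" "path (Suc k)"]) (use k inner_path_Suc in \<open>auto simp: V_eq\<close>)
qed

section \<open>Unisolvence of affine interpolation at the vertices\<close>

lemma affine_eqI:
  assumes "\<And>v. v \<in> V \<Longrightarrow> c \<bullet> v + \<beta> = c' \<bullet> v + \<beta>'"
  shows "c = c'" "\<beta> = \<beta>'"
proof -
  have "c $ i = c' $ i" for i
  proof -
    obtain v v' where v: "v \<in> V" "v' \<in> V" and e: "\<And>c. c \<bullet> v' = c \<bullet> v + c $ i * len i"
      by (rule edge[of i]) blast
    have "c $ i * len i = c' $ i * len i"
      using assms[OF v(1)] assms[OF v(2)] unfolding e by linarith
    then show ?thesis by simp
  qed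
  then show "c = c'" by (simp add: vec_eq_iff)
  moreover have "path 0 \<in> V" by (simp add: V_eq)
  ultimately show "\<beta> = \<beta>'" using assms[of "path 0"] by simp
qed

lemma affine_interpolation:
  obtains c \<beta> where "\<And>v. v \<in> V \<Longrightarrow> c \<bullet> v + \<beta> = f v"
proof -
  \<comment> \<open>\<open>\<kappa> i\<close> is the step of the walk that moves in direction
    \<open>i\<close>; the component \<open>c $ i\<close> is then the difference quotient of
    \<open>f\<close> along that edge.\<close>
  define \<kappa> where "\<kappa> = inv_into {..<CARD('n)} \<pi>"
  have \<kappa>: "\<kappa> (\<pi> k) = k" if "k < CARD('n)" for k
    unfolding \<kappa>_def using bij that by (simp add: bij_betw_def inv_into_f_f)
  define c :: "real^'n" where "c = (\<chi> i. (f (path (Suc (\<kappa> i))) - f (path (\<kappa> i))) / len i)"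
  define \<beta> where "\<beta> = f (path 0) - c \<bullet> path 0"
  have "c \<bullet> path k + \<beta> = f (path k)" if "k \<le> CARD('n)" for k
    using that
  proof (induction k)
    case 0
    show ?case by (simp add: \<beta>_def)
  next
    case (Suc k)
    then show ?case by (simp add: inner_path_Suc c_def[THEN arg_cong, of "\<lambda>c. c $ \<pi> k"] \<kappa>)
  qed
  then show thesis by (intro that[of c \<beta>]) (auto simp: V_eq)
qed

lemma simplex_interp_affine:
  obtains c \<beta> where "simplex_interp V f = (\<lambda>x. c \<bullet> x + \<beta>)" "\<And>v. v \<in> V \<Longrightarrow> c \<bullet> v + \<beta> = f v"
proof -
  obtain c \<beta> where c: "\<And>v. v \<in> V \<Longrightarrow> c \<bullet> v + \<beta> = f v"
    using affine_interpolation by blast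
  have "simplex_interp V f = (\<lambda>x. c \<bullet> x + \<beta>)"
    unfolding simplex_interp_def
  proof (rule the_equality)
    show "P1_on UNIV (\<lambda>x. c \<bullet> x + \<beta>) \<and> (\<forall>a\<in>V. c \<bullet> a + \<beta> = f a)"
      using c by (auto simp: P1_on_def)
  next
    fix l assume l: "P1_on UNIV l \<and> (\<forall>a\<in>V. l a = f a)"
    then obtain c' \<beta>' where l': "l = (\<lambda>x. c' \<bullet> x + \<beta>')"
      unfolding P1_on_def by (metis UNIV_I ext)
    then have "c' = c" "\<beta>' = \<beta>"
      using affine_eqI[of c' \<beta>' c \<beta>] l c by auto
    then show "l = (\<lambda>x. c \<bullet> x + \<beta>)" using l' by simp
  qed
  then show thesis using c that by blast
qed

text \<open>The edges of the path are parallel to the axes, and along each of them \<open>max 0 L\<close> changes in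
  the same direction as \<open>L\<close>, but not more; so the bounds hold coordinate by coordinate.\<close>

lemma slope_interp_positive_part:
  assumes k: "\<And>v. v \<in> V \<Longrightarrow> k \<bullet> v + \<gamma> = max 0 (n \<bullet> v + \<beta>)"
  shows "0 \<le> k \<bullet> n" "k \<bullet> n \<le> n \<bullet> n"
proof -
  have "0 \<le> k $ i * n $ i \<and> k $ i * n $ i \<le> n $ i * n $ i" for i
  proof -
    obtain v v' where v: "v \<in> V" "v' \<in> V" and e: "\<And>c. c \<bullet> v' = c \<bullet> v + c $ i * len i"
      by (rule edge[of i]) blast
    define x where "x = k $ i * len i"
    define y where "y = n $ i * len i"
    have x: "x = max 0 (n \<bullet> v + \<beta> + y) - max 0 (n \<bullet> v + \<beta>)"
      using k[OF v(1)] k[OF v(2)] e[of k] e[of n] by (simp add: x_def y_def)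
    have "0 \<le> x \<and> x \<le> y \<or> y \<le> x \<and> x \<le> 0"
      unfolding x by (auto simp: max_def)
    then have "0 \<le> x * y \<and> x * y \<le> y * y"
      by (auto intro: mult_nonneg_nonneg mult_nonpos_nonpos mult_right_mono mult_right_mono_neg)
    moreover have "x * y = (k $ i * n $ i) * (len i)\<^sup>2" "y * y = (n $ i * n $ i) * (len i)\<^sup>2"
      by (simp_all add: x_def y_def power2_eq_square)
    moreover have "(len i)\<^sup>2 > 0" by simp
    ultimately show ?thesis
      by (metis mult_le_cancel_right_pos zero_le_mult_iff not_less)
  qed
  then show "0 \<le> k \<bullet> n" "k \<bullet> n \<le> n \<bullet> n"
    by (auto simp: inner_vec_def intro!: sum_nonneg sum_mono)
qed

section \<open>Order of the scaled coordinates on a Kuhn simplex\<close>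

lemma path_in_cell: "path k \<in> cbox lo hi"
  using lo_less_hi by (auto simp: mem_box_cart path_def cell_corner_def less_imp_le)

lemma hull_subset_cell: "convex hull V \<subseteq> cbox lo hi"
  by (rule hull_minimal) (auto simp: V_eq path_in_cell)

lemma coord_path: "coord (path k) i = (if i \<in> \<pi> ` {..<k} then 1 else 0)"
  unfolding coord_def by (subst path_nth) simp

text \<open>At every vertex the coordinate \<open>\<pi> j\<close> has been switched from 0 to 1 no
  later than \<open>\<pi> k\<close>, so all vertices lie in one closed half-space. Taking interiors
  turns it into the open half-space, which gives strictness.\<close>

lemma hull_order:
  assumes "j < k" "k < CARD('n)"
  shows "y \<in> convex hull V \<Longrightarrow> coord y (\<pi> k) \<le> coord y (\<pi> j)"
    and "y \<in> element V \<Longrightarrow> coord y (\<pi> k) < coord y (\<pi> j)"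
proof -
  define c :: "real^'n" where
    "c = axis (\<pi> j) (1 / len (\<pi> j)) - axis (\<pi> k) (1 / len (\<pi> k))"
  have c: "coord y (\<pi> j) - coord y (\<pi> k) = c \<bullet> y - c \<bullet> path 0" for y
    by (simp add: coord_def c_def inner_diff_left inner_axis' diff_divide_distrib)
  have "\<pi> j \<noteq> \<pi> k" using inj_index assms by simp
  then have "c $ \<pi> j \<noteq> 0" by (simp add: c_def axis_def)
  then have c0: "c \<noteq> 0" by auto
  have "coord (path m) (\<pi> k) \<le> coord (path m) (\<pi> j)" if "m \<le> CARD('n)" for m
    using assms that index_in_image[of k m] index_in_image[of j m] by (simp add: coord_path)
  then have "c \<bullet> path m \<ge> c \<bullet> path 0" if "m \<le> CARD('n)" for m
    using c[of "path m"] that by (metis diff_ge_0_iff_ge)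
  then have "V \<subseteq> {y. c \<bullet> y \<ge> c \<bullet> path 0}"
    by (auto simp: V_eq)
  then have hull: "convex hull V \<subseteq> {y. c \<bullet> y \<ge> c \<bullet> path 0}"
    by (rule hull_minimal) (rule convex_halfspace_ge)
  then show "y \<in> convex hull V \<Longrightarrow> coord y (\<pi> k) \<le> coord y (\<pi> j)"
    using c[of y] by auto
  have "element V \<subseteq> {y. c \<bullet> y > c \<bullet> path 0}"
    unfolding element_def using interior_mono[OF hull] interior_halfspace_ge[OF c0] by simp
  then show "y \<in> element V \<Longrightarrow> coord y (\<pi> k) < coord y (\<pi> j)"
    using c[of y] by auto
qed

lemma element_subset_box: "element V \<subseteq> box lo hi"
  unfolding element_def using interior_mono[OF hull_subset_cell] by (simp add: interior_cbox)

text \<open>A corner has scaled coordinates 0 or 1, and \<open>hull_order\<close> makes them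
  decrease along \<pi>: a block of ones followed by zeros, which is a vertex of the walk.\<close>

lemma corner_in_hull:
  assumes y: "y \<in> convex hull V" and corner: "\<And>i. y $ i = lo $ i \<or> y $ i = hi $ i"
  shows "y \<in> V"
proof -
  have nth: "y $ i = path 0 $ i + coord y i * len i" for i
    by (simp add: coord_def)
  have c01: "coord y i = 0 \<or> coord y i = 1" for i
    using corner[of i] lo_less_hi[of i]
    by (auto simp: coord_def path_def cell_corner_def len_def)
  \<comment> \<open>The first zero along the walk; the disjunct \<open>k = CARD('n)\<close> covers
    the end corner, where no coordinate vanishes.\<close>
  define k where "k = (LEAST k. k = CARD('n) \<or> coord y (\<pi> k) = 0)"
  have k: "k = CARD('n) \<or> coord y (\<pi> k) = 0"
    unfolding k_def by (rule LeastI[of _ "CARD('n)"]) simp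
  have kN: "k \<le> CARD('n)"
    unfolding k_def by (rule Least_le) simp
  have low: "coord y (\<pi> j) = 1" if "j < k" for j
    using not_less_Least[OF that[unfolded k_def]] c01[of "\<pi> j"] by auto
  have high: "coord y (\<pi> j) = 0" if "k \<le> j" "j < CARD('n)" for j
    using k hull_order(1)[OF _ that(2) y, of k] c01[of "\<pi> j"] that
    by (cases "k = j") auto
  have "y = path k"
  proof (subst vec_eq_iff, intro allI)
    fix i
    obtain j where j: "j < CARD('n)" "i = \<pi> j" by (rule index)
    then show "y $ i = path k $ i"
      using low[of j] high[of j] index_in_image[OF j(1) kN]
      by (simp add: nth[of "\<pi> j"] path_nth[of k] not_less)
  qed
  then show ?thesis using kN by (simp add: V_eq)
qed

end

section \<open>Cartesian meshes\<close>

text \<open>Along \<pi> the scaled coordinates of \<open>x\<close> decrease strictly, along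
  \<open>\<pi>'\<close> weakly. Hence for each \<open>k\<close> the first \<open>k\<close>
  directions of both walks carry the \<open>k\<close> largest coordinates, and strictness leaves no
  choice among them. These prefixes determine the vertices.\<close>

lemma kuhn_unique:
  fixes lo hi :: "real^'n"
  assumes k1: "kuhn lo hi \<pi>" and k2: "kuhn lo hi \<pi>'"
    and x: "x \<in> element (kuhn_simplex lo hi S \<pi>)" "x \<in> convex hull (kuhn_simplex lo hi S \<pi>')"
  shows "kuhn_simplex lo hi S \<pi> = kuhn_simplex lo hi S \<pi>'"
proof -
  interpret A: kuhn lo hi S \<pi> by fact
  interpret B: kuhn lo hi S \<pi>' by fact
  have coord: "B.coord y i = A.coord y i" for y i
    unfolding A.coord_def B.coord_def A.path_def B.path_def by simp
  define r where "r i = A.coord x i" for i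
  have sA: "r (\<pi> k) < r (\<pi> j)" if "j < k" "k < CARD('n)" for j k
    using A.hull_order(2)[OF that x(1)] by (simp add: r_def)
  have sB: "r (\<pi>' k) \<le> r (\<pi>' j)" if "j < k" "k < CARD('n)" for j k
    using B.hull_order(1)[OF that x(2)] by (simp add: r_def coord)
  have "\<pi> ` {..<k} = \<pi>' ` {..<k}" if k: "k \<le> CARD('n)" for k
  proof -
    have cA: "card (\<pi> ` {..<k}) = k" and cB: "card (\<pi>' ` {..<k}) = k"
      using A.bij B.bij k inj_on_subset[of _ "{..<CARD('n)}" "{..<k}"]
      by (auto simp: bij_betw_def intro!: card_image[THEN trans])
    have upA: "r j < r i" if "i \<in> \<pi> ` {..<k}" "j \<notin> \<pi> ` {..<k}" for i j
    proof -
      obtain b where b: "b < CARD('n)" "j = \<pi> b" by (rule A.index)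
      obtain a where a: "a < k" "i = \<pi> a" using \<open>i \<in> \<pi> ` {..<k}\<close> by blast
      have "k \<le> b" using A.index_in_image[OF b(1) k] b that by simp
      then show ?thesis using sA[of a b] a b by simp
    qed
    have upB: "r j \<le> r i" if "i \<in> \<pi>' ` {..<k}" "j \<notin> \<pi>' ` {..<k}" for i j
    proof -
      obtain b where b: "b < CARD('n)" "j = \<pi>' b" by (rule B.index)
      obtain a where a: "a < k" "i = \<pi>' a" using \<open>i \<in> \<pi>' ` {..<k}\<close> by blast
      have "k \<le> b" using B.index_in_image[OF b(1) k] b that by simp
      then show ?thesis using sB[of a b] a b by simp
    qed
    \<comment> \<open>Exchange argument: an index belonging only to the first prefix and one
      belonging only to the second would be ordered in both ways. Inclusion suffices since the
      prefixes have equal size.\<close>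
    have "\<pi> ` {..<k} \<subseteq> \<pi>' ` {..<k} \<or> \<pi>' ` {..<k} \<subseteq> \<pi> ` {..<k}"
    proof (rule ccontr)
      assume "\<not> ?thesis"
      then obtain i j where "i \<in> \<pi> ` {..<k}" "i \<notin> \<pi>' ` {..<k}" "j \<in> \<pi>' ` {..<k}" "j \<notin> \<pi> ` {..<k}"
        by blast
      then show False using upA[of i j] upB[of j i] by simp
    qed
    then show ?thesis using cA cB by (metis card_subset_eq finite_imageI finite_lessThan)
  qed
  then show ?thesis by (simp add: kuhn_simplex_def)
qed

section \<open>Relative position of two elements of one tensor grid\<close>

definition grid_simplex ::
  "('n \<Rightarrow> nat) \<Rightarrow> ('n \<Rightarrow> nat \<Rightarrow> real) \<Rightarrow> 'n set \<Rightarrow> ('n \<Rightarrow> nat) \<Rightarrow> (nat \<Rightarrow> 'n) \<Rightarrow> (real^'n) set \<Rightarrow> bool"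
  where
  "grid_simplex K X S m \<pi> V \<longleftrightarrow>
     V = kuhn_simplex (\<chi> i. X i (m i)) (\<chi> i. X i (Suc (m i))) S \<pi> \<and> (\<forall>i. m i < K i) \<and>
     kuhn (\<chi> i. X i (m i)) (\<chi> i. X i (Suc (m i))) \<pi>"

text \<open>Strict monotonicity is restated as an equivalence so that comparing grid values becomes
  comparing indices. The grid and \<open>S\<close> are obtained once, for all elements, because the
  lemmas below compare two of them.\<close>

lemma cartesian_mesh_obtain_kuhn:
  fixes a b :: "real^'n"
  assumes "cartesian_mesh a b \<T>"
  obtains X K S where
    "\<And>i j k. j \<le> K i \<Longrightarrow> k \<le> K i \<Longrightarrow> X i j \<le> X i k \<longleftrightarrow> j \<le> k"
    "\<And>i. X i 0 = a $ i" "\<And>i. X i (K i) = b $ i"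
    "\<And>V. V \<in> \<T> \<Longrightarrow> \<exists>m \<pi>. grid_simplex K X S m \<pi> V"
proof -
  obtain K :: "'n \<Rightarrow> nat" and X S where
    X: "\<And>i. strict_mono_on {..K i} (X i)" "\<And>i. X i 0 = a $ i" "\<And>i. X i (K i) = b $ i"
    and T: "\<T> = {kuhn_simplex (\<chi> i. X i (m i)) (\<chi> i. X i (Suc (m i))) S \<pi> | m \<pi>.
               (\<forall>i. m i < K i) \<and> bij_betw \<pi> {..<CARD('n)} UNIV}"
    using assms unfolding cartesian_mesh_def by blast
  show thesis
  proof (rule that[of K X S])
    show "X i j \<le> X i k \<longleftrightarrow> j \<le> k" if "j \<le> K i" "k \<le> K i" for i j k
      using strict_mono_on_leD[OF X(1), of j i k] strict_mono_onD[OF X(1), of k i j] that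
      by (metis atMost_iff linorder_not_less)
    show "\<exists>m \<pi>. grid_simplex K X S m \<pi> V"
      if "V \<in> \<T>" for V
    proof -
      obtain m \<pi> where V: "V = kuhn_simplex (\<chi> i. X i (m i)) (\<chi> i. X i (Suc (m i))) S \<pi>"
        and m: "\<forall>i. m i < K i" and bij: "bij_betw \<pi> {..<CARD('n)} UNIV"
        using \<open>V \<in> \<T>\<close> unfolding T mem_Collect_eq by metis
      have "X i (m i) < X i (Suc (m i))" for i
        using strict_mono_onD[OF X(1)[of i], of "m i" "Suc (m i)"] m
        by (simp add: Suc_le_eq less_imp_le)
      then have "kuhn (\<chi> i. X i (m i)) (\<chi> i. X i (Suc (m i))) \<pi>"
        using bij by (simp add: kuhn_def)
      then show ?thesis using V m by (auto simp: grid_simplex_def)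
    qed
  qed (use X in auto)
qed

text \<open>The open cell of \<open>V\<close> meets the closed cell of \<open>V'\<close> only if all
  indices agree, and inside one cell \<open>kuhn_unique\<close> decides. The asymmetry between open
  element and closed hull is the one needed for the choice in \<open>mesh_interp\<close>.\<close>

lemma mesh_element_unique:
  assumes mesh: "cartesian_mesh a b \<T>" and V: "V \<in> \<T>" "V' \<in> \<T>"
    and x: "x \<in> element V" "x \<in> convex hull V'"
  shows "V' = V"
proof -
  obtain X K S where
    X: "\<And>i j k. j \<le> K i \<Longrightarrow> k \<le> K i \<Longrightarrow> X i j \<le> X i k \<longleftrightarrow> j \<le> k"
    and X0: "\<And>i. X i 0 = a $ i" "\<And>i. X i (K i) = b $ i"
    and T: "\<And>V. V \<in> \<T> \<Longrightarrow> \<exists>m \<pi>. grid_simplex K X S m \<pi> V"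
    by (rule cartesian_mesh_obtain_kuhn[OF mesh]) (rule that)
  obtain m \<pi> where V1: "V = kuhn_simplex (\<chi> i. X i (m i)) (\<chi> i. X i (Suc (m i))) S \<pi>"
    and m: "\<And>i. m i < K i" and k1: "kuhn (\<chi> i. X i (m i)) (\<chi> i. X i (Suc (m i))) \<pi>"
    using T[OF V(1)] by (auto simp: grid_simplex_def)
  obtain m' \<pi>' where V2: "V' = kuhn_simplex (\<chi> i. X i (m' i)) (\<chi> i. X i (Suc (m' i))) S \<pi>'"
    and m': "\<And>i. m' i < K i" and k2: "kuhn (\<chi> i. X i (m' i)) (\<chi> i. X i (Suc (m' i))) \<pi>'"
    using T[OF V(2)] by (auto simp: grid_simplex_def)
  have "m' i = m i" for i
  proof -
    have "X i (m i) < x $ i" "x $ i < X i (Suc (m i))"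
      using subsetD[OF kuhn.element_subset_box[OF k1] x(1)[unfolded V1]] by (auto simp: mem_box_cart)
    moreover have "X i (m' i) \<le> x $ i" "x $ i \<le> X i (Suc (m' i))"
      using subsetD[OF kuhn.hull_subset_cell[OF k2] x(2)[unfolded V2]] by (auto simp: mem_box_cart)
    ultimately have "X i (m' i) < X i (Suc (m i))" "X i (m i) < X i (Suc (m' i))"
      by linarith+
    then show ?thesis
      using X[of "Suc (m i)" i "m' i"] X[of "Suc (m' i)" i "m i"] m[of i] m'[of i] by simp
  qed
  then have "m' = m" by blast
  then show ?thesis using kuhn_unique[OF k1] k2 x V1 V2 by blast
qed

text \<open>This is the conformity of the mesh. A grid value between two consecutive grid values is
  one of them, so \<open>x\<close> is a corner of the cell of \<open>V'\<close>, and
  \<open>corner_in_hull\<close> applies.\<close>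

lemma mesh_vertex_in_hull:
  assumes mesh: "cartesian_mesh a b \<T>" and V: "V \<in> \<T>" "V' \<in> \<T>"
    and x: "x \<in> V" "x \<in> convex hull V'"
  shows "x \<in> V'"
proof -
  obtain X K S where
    X: "\<And>i j k. j \<le> K i \<Longrightarrow> k \<le> K i \<Longrightarrow> X i j \<le> X i k \<longleftrightarrow> j \<le> k"
    and X0: "\<And>i. X i 0 = a $ i" "\<And>i. X i (K i) = b $ i"
    and T: "\<And>V. V \<in> \<T> \<Longrightarrow> \<exists>m \<pi>. grid_simplex K X S m \<pi> V"
    by (rule cartesian_mesh_obtain_kuhn[OF mesh]) (rule that)
  obtain m \<pi> where V1: "V = kuhn_simplex (\<chi> i. X i (m i)) (\<chi> i. X i (Suc (m i))) S \<pi>"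
    and m: "\<And>i. m i < K i"
    using T[OF V(1)] by (auto simp: grid_simplex_def)
  obtain m' \<pi>' where V2: "V' = kuhn_simplex (\<chi> i. X i (m' i)) (\<chi> i. X i (Suc (m' i))) S \<pi>'"
    and m': "\<And>i. m' i < K i" and k2: "kuhn (\<chi> i. X i (m' i)) (\<chi> i. X i (Suc (m' i))) \<pi>'"
    using T[OF V(2)] by (auto simp: grid_simplex_def)
  have "x $ i = X i (m' i) \<or> x $ i = X i (Suc (m' i))" for i
  proof -
    have "x $ i = X i (m i) \<or> x $ i = X i (Suc (m i))"
      using x(1) by (auto simp: V1 kuhn_simplex_def cell_corner_def)
    then obtain j where j: "j \<le> K i" "x $ i = X i j"
      using m[of i] by (metis less_imp_le Suc_leI)
    have "X i (m' i) \<le> x $ i" "x $ i \<le> X i (Suc (m' i))"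
      using subsetD[OF kuhn.hull_subset_cell[OF k2] x(2)[unfolded V2]] by (auto simp: mem_box_cart)
    then have "m' i \<le> j" "j \<le> Suc (m' i)"
      using X[of "m' i" i j] X[of j i "Suc (m' i)"] m'[of i] j by auto
    then show ?thesis using j by (metis le_Suc_eq le_antisym)
  qed
  then show ?thesis
    using kuhn.corner_in_hull[OF k2] x(2) by (simp add: V2)
qed

lemma mesh_subset_cbox:
  assumes mesh: "cartesian_mesh a b \<T>" and V: "V \<in> \<T>"
  shows "convex hull V \<subseteq> cbox a b"
proof -
  obtain X K S where
    X: "\<And>i j k. j \<le> K i \<Longrightarrow> k \<le> K i \<Longrightarrow> X i j \<le> X i k \<longleftrightarrow> j \<le> k"
    and X0: "\<And>i. X i 0 = a $ i" "\<And>i. X i (K i) = b $ i"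
    and T: "\<And>V. V \<in> \<T> \<Longrightarrow> \<exists>m \<pi>. grid_simplex K X S m \<pi> V"
    by (rule cartesian_mesh_obtain_kuhn[OF mesh]) (rule that)
  obtain m \<pi> where V1: "V = kuhn_simplex (\<chi> i. X i (m i)) (\<chi> i. X i (Suc (m i))) S \<pi>"
    and m: "\<And>i. m i < K i" and k1: "kuhn (\<chi> i. X i (m i)) (\<chi> i. X i (Suc (m i))) \<pi>"
    using T[OF V(1)] by (auto simp: grid_simplex_def)
  have "a $ i \<le> X i (m i)" "X i (Suc (m i)) \<le> b $ i" for i
    using X[of 0 i "m i"] X[of "Suc (m i)" i "K i"] m[of i] X0 by auto
  then have "cbox (\<chi> i. X i (m i)) (\<chi> i. X i (Suc (m i))) \<subseteq> cbox a b"
    by (auto simp: mem_box_cart) (meson order_trans)+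
  then show ?thesis using order_trans[OF kuhn.hull_subset_cell[OF k1]] V1 by blast
qed

lemma mesh_kuhn:
  assumes mesh: "cartesian_mesh a b \<T>" and V: "V \<in> \<T>"
  obtains lo hi S \<pi> where "V = kuhn_simplex lo hi S \<pi>" "kuhn lo hi \<pi>"
  by (rule cartesian_mesh_obtain_kuhn[OF mesh]) (metis V grid_simplex_def that)

section \<open>Local description of the global interpolant\<close>

lemma mesh_interp_element:
  assumes "cartesian_mesh a b \<T>" "V \<in> \<T>" "x \<in> element V"
  shows "mesh_interp \<T> f x = simplex_interp V f x"
proof -
  have "x \<in> convex hull V" using assms(3) interior_subset by (auto simp: element_def)
  then have "(SOME V. V \<in> \<T> \<and> x \<in> convex hull V) = V"
    using assms mesh_element_unique by (intro some_equality) blast+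
  then show ?thesis by (simp add: mesh_interp_def)
qed

text \<open>The element chosen at \<open>x\<close> need not be \<open>V\<close>, but
  \<open>x\<close> is one of its vertices too, so its interpolant reproduces
  \<open>f x\<close>.\<close>

lemma mesh_interp_vertex:
  assumes mesh: "cartesian_mesh a b \<T>" and V: "V \<in> \<T>" and x: "x \<in> V"
  shows "mesh_interp \<T> f x = f x"
proof -
  define V' where "V' = (SOME V. V \<in> \<T> \<and> x \<in> convex hull V)"
  have "V' \<in> \<T> \<and> x \<in> convex hull V'"
    unfolding V'_def by (rule someI[of _ V]) (use V x hull_inc in auto)
  then have V': "V' \<in> \<T>" "x \<in> V'"
    using mesh_vertex_in_hull[OF mesh V _ x] by auto
  obtain lo hi S \<pi> where k: "V' = kuhn_simplex lo hi S \<pi>" "kuhn lo hi \<pi>"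
    using mesh_kuhn[OF mesh V'(1)] .
  obtain c \<beta> where "simplex_interp V' f = (\<lambda>x. c \<bullet> x + \<beta>)" "\<And>v. v \<in> V' \<Longrightarrow> c \<bullet> v + \<beta> = f v"
    using kuhn.simplex_interp_affine[OF k(2), of S f] unfolding k(1) by blast
  then have "simplex_interp V' f x = f x" using V'(2) by simp
  then show ?thesis by (simp add: mesh_interp_def V'_def)
qed

section \<open>Piecewise affine fields\<close>

text \<open>The gradient of a piecewise affine field that is continuous across a hyperplane jumps by
  such a rank-one matrix.\<close>

definition outer :: "real^'n \<Rightarrow> real^'n \<Rightarrow> real^'n^'n" where
  "outer a c = (\<chi> i j. a $ i * c $ j)"

lemma outer_mult_vec: "outer a c *v v = (c \<bullet> v) *\<^sub>R a"
  by (simp add: vec_eq_iff outer_def matrix_vector_mult_def inner_vec_def sum_distrib_left mult_ac)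

lemma transpose_outer: "transpose (outer a c) = outer c a"
  by (simp add: vec_eq_iff outer_def transpose_def mult.commute)

lemma trace_outer: "trace (outer a c) = a \<bullet> c"
  by (simp add: trace_def outer_def inner_vec_def)

lemma matrix_eq_outer:
  fixes A :: "real^'n^'n"
  assumes n: "n \<bullet> n = 1" and tangential: "\<And>v. n \<bullet> v = 0 \<Longrightarrow> A *v v = 0"
  shows "A = outer (A *v n) n"
proof (subst matrix_eq, intro allI)
  fix x
  have "A *v (x - (n \<bullet> x) *\<^sub>R n) = 0"
    by (rule tangential) (simp add: inner_diff_right n)
  then show "A *v x = outer (A *v n) n *v x"
    by (simp add: outer_mult_vec matrix_vector_mult_diff_distrib matrix_vector_mult_scaleR)
qed

lemma P1_on_vector:
  fixes u :: "real^'n \<Rightarrow> real^'n"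
  assumes "\<And>i. P1_on A (\<lambda>x. u x $ i)"
  obtains M b where "\<And>x. x \<in> A \<Longrightarrow> u x = M *v x + b"
proof -
  have "\<forall>i. \<exists>c \<beta>. \<forall>x\<in>A. u x $ i = c \<bullet> x + \<beta>"
    using assms by (simp add: P1_on_def)
  then obtain c \<beta> where "\<forall>i. \<forall>x\<in>A. u x $ i = c i \<bullet> x + \<beta> i"
    by metis
  then have "u x = (\<chi> i. c i) *v x + (\<chi> i. \<beta> i)" if "x \<in> A" for x
    using that by (simp add: vec_eq_iff matrix_vector_mul_component)
  then show thesis using that by blast
qed

lemma jacobian_affine_on:
  fixes u :: "real^'n \<Rightarrow> real^'n"
  assumes "open A" "y \<in> A" "\<And>x. x \<in> A \<Longrightarrow> u x = M *v x + b"
  shows "jacobian u (at y) = M"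
proof -
  have "((\<lambda>x. M *v x + b) has_derivative (*v) M) (at y)"
    by (auto intro!: derivative_eq_intros bounded_linear_imp_has_derivative)
  then have "(u has_derivative (*v) M) (at y)"
    by (rule has_derivative_transform_within_open[OF _ assms(1,2)]) (simp add: assms(3))
  then show ?thesis
    by (simp add: jacobian_def frechet_derivative_at[symmetric] matrix_of_matrix_vector_mul)
qed

lemma grad_affine_on:
  assumes "open A" "y \<in> A" "\<And>x. x \<in> A \<Longrightarrow> f x = c \<bullet> x + \<beta>"
  shows "grad f y = c"
proof -
  have "((\<lambda>x. c \<bullet> x + \<beta>) has_derivative (\<lambda>h. c \<bullet> h)) (at y)"
    by (auto intro!: derivative_eq_intros)
  then have "(f has_derivative (\<lambda>h. c \<bullet> h)) (at y)"
    by (rule has_derivative_transform_within_open[OF _ assms(1,2)]) (simp add: assms(3))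
  then show ?thesis
    by (simp add: grad_def frechet_derivative_at[symmetric] vec_eq_iff inner_axis)
qed

text \<open>\<open>Lim\<close> is a definite description and yields the trace only along a
  nontrivial filter. The values of \<open>f\<close> at \<open>a\<close> itself are unknown, so the
  limit is expressed by a continuous \<open>g\<close> defined everywhere.\<close>

lemma Lim_within_eq:
  fixes f g :: "'a::t2_space \<Rightarrow> 'b::t2_space"
  assumes "at a within A \<noteq> bot" "\<And>x. x \<in> A \<Longrightarrow> f x = g x" "isCont g a"
  shows "Lim (at a within A) f = g a"
proof -
  have "(g \<longlongrightarrow> g a) (at a within A)"
    using assms(3) continuous_at_imp_continuous_at_within continuous_within by blast
  moreover have "\<forall>\<^sub>F x in at a within A. g x = f x"
    using assms(2) by (auto simp: eventually_at_filter)
  ultimately have "(f \<longlongrightarrow> g a) (at a within A)"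
    by (rule Lim_transform_eventually)
  then show ?thesis using assms(1) by (simp add: tendsto_Lim)
qed

section \<open>A simplex cut by a hyperplane\<close>

lemma eventually_step_in_open:
  fixes x :: "'a::real_normed_vector"
  assumes "open T" "x \<in> T"
  shows "\<forall>\<^sub>F e in at_right 0. e > 0 \<and> x + e *\<^sub>R v \<in> T"
proof -
  have "((\<lambda>e. x + e *\<^sub>R v) \<longlongrightarrow> x + 0 *\<^sub>R v) (at_right 0)"
    by (intro tendsto_intros)
  then have "\<forall>\<^sub>F e in at_right 0. x + e *\<^sub>R v \<in> T"
    using assms by (intro topological_tendstoD) auto
  moreover have "\<forall>\<^sub>F e::real in at_right 0. e > 0"
    by (simp add: eventually_at_right_less)
  ultimately show ?thesis
    by eventually_elim simp
qed

text \<open>The sets \<open>P\<close>, \<open>M\<close>, \<open>G\<close> are global, and only their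
  traces on one element are prescribed. The condition on \<open>P\<close> includes the vertices
  because \<open>vertex_value\<close> tests them for membership in \<open>P\<close>.\<close>

locale cut_simplex = kuhn lo hi S \<pi>
  for lo hi :: "real^'n" and S :: "'n set" and \<pi> :: "nat \<Rightarrow> 'n" +
  fixes n xs :: "real^'n" and P M G :: "(real^'n) set"
  assumes xs: "xs \<in> element V"
    and unit: "n \<bullet> n = 1"
    and plus: "x \<in> element V \<union> V \<Longrightarrow> x \<in> P \<longleftrightarrow> n \<bullet> (x - xs) > 0"
    and minus: "x \<in> element V \<Longrightarrow> x \<in> M \<longleftrightarrow> n \<bullet> (x - xs) < 0"
    and middle: "x \<in> element V \<Longrightarrow> x \<in> G \<longleftrightarrow> n \<bullet> (x - xs) = 0"
begin

abbreviation "T \<equiv> element V"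
abbreviation "Tp \<equiv> T \<inter> P"
abbreviation "Tm \<equiv> T \<inter> M"

lemma open_T: "open T" and convex_T: "convex T"
  by (simp_all add: element_def convex_interior)

lemma Tp_eq: "Tp = T \<inter> {x. n \<bullet> (x - xs) > 0}" and Tm_eq: "Tm = T \<inter> {x. n \<bullet> (x - xs) < 0}"
  using plus minus by auto

lemma open_Tp: "open Tp" and open_Tm: "open Tm"
  unfolding Tp_eq Tm_eq
  by (auto intro!: open_Int open_T open_Collect_less continuous_intros)

lemma V_closure: "V \<subseteq> closure T"
proof -
  have "compact (convex hull V)"
    unfolding V_eq by (intro compact_convex_hull finite_imp_compact) simp
  then have "closure T = convex hull V"
    unfolding element_def
    using xs by (subst convex_closure_interior) (auto simp: element_def compact_imp_closed)
  then show ?thesis by (simp add: hull_subset)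
qed

lemma step_in_T: obtains e where "e > 0" "xs + e *\<^sub>R v \<in> T"
  using eventually_happens'[OF trivial_limit_at_right_real eventually_step_in_open[OF open_T xs]] that
  by blast

text \<open>On the segment from \<open>a\<close> to a point \<open>xs + e *\<^sub>R c\<close> of
  \<open>T\<close>, every point except possibly \<open>a\<close> lies in \<open>T\<close> by
  convexity and has positive level, even if \<open>a\<close> is a vertex of level 0. The choices
  \<open>c = n\<close> and \<open>c = - n\<close> serve the two sides.\<close>

lemma nontrivial_halfspace:
  assumes a: "a \<in> closure T" "c \<bullet> (a - xs) \<ge> 0" and c: "c \<bullet> c = 1"
    and A: "A = T \<inter> {x. c \<bullet> (x - xs) > 0}"
  shows "at a within A \<noteq> bot"
proof -
  obtain e where e: "e > 0" "xs + e *\<^sub>R c \<in> T" by (rule step_in_T)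
  define y where "y = xs + e *\<^sub>R c"
  have "c \<bullet> (y - xs) = e" using c by (simp add: y_def)
  have in_A: "a - s *\<^sub>R (a - y) \<in> A" if "0 < s" "s \<le> 1" for s
  proof -
    have "a - s *\<^sub>R (a - y) \<in> T"
      using mem_interior_closure_convex_shrink[OF convex_T, of y a s] e(2) a(1) that open_T
      by (simp add: y_def interior_open)
    moreover have "c \<bullet> (a - s *\<^sub>R (a - y) - xs) = (1 - s) * (c \<bullet> (a - xs)) + s * (c \<bullet> (y - xs))"
      by (simp add: algebra_simps inner_diff_right)
    moreover have "\<dots> > 0"
      using that a(2) e(1) \<open>c \<bullet> (y - xs) = e\<close> by (intro add_nonneg_pos) auto
    ultimately show ?thesis by (simp add: A)
  qed
  have "((\<lambda>s. a - s *\<^sub>R (a - y)) \<longlongrightarrow> a - 0 *\<^sub>R (a - y)) (at_right 0)"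
    by (intro tendsto_intros)
  then have lim: "((\<lambda>s. a - s *\<^sub>R (a - y)) \<longlongrightarrow> a) (at_right 0)" by simp
  have "\<forall>\<^sub>F s in at_right 0. a - s *\<^sub>R (a - y) \<in> A"
    by (rule eventually_at_rightI[of 0 1]) (use in_A in auto)
  then have "a \<in> closure A"
    using lim Lim_in_closed_set[OF closed_closure, of _ A "at_right 0" a]
    by (metis (mono_tags, lifting) closure_subset eventually_mono subsetD trivial_limit_at_right_real)
  moreover have "open A"
    unfolding A by (auto intro!: open_Int open_T open_Collect_less continuous_intros)
  \<comment> \<open>In the closure of an open set every point is a limit point, so the case that
    \<open>a\<close> lies in \<open>A\<close> needs no separate treatment.\<close>
  ultimately have "a islimpt A"
    using islimpt_closure_open limpt_of_closure by blast
  then show ?thesis by (simp add: trivial_limit_within)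
qed

lemma at_within_Tp: "a \<in> closure T \<Longrightarrow> n \<bullet> (a - xs) \<ge> 0 \<Longrightarrow> at a within Tp \<noteq> bot"
  by (rule nontrivial_halfspace[OF _ _ unit Tp_eq])

lemma at_within_Tm: "a \<in> closure T \<Longrightarrow> n \<bullet> (a - xs) \<le> 0 \<Longrightarrow> at a within Tm \<noteq> bot"
  by (rule nontrivial_halfspace[of _ "- n"]) (use unit Tm_eq in auto)

text \<open>A vertex on the cut has level 0 and falls into the minus branch; the trace from
  \<open>Tm\<close> exists there because \<open>at_within_Tm\<close> admits level 0.\<close>

lemma vertex_value_eq:
  assumes "a \<in> V" "\<And>x. x \<in> Tp \<Longrightarrow> v x = vp x" "\<And>x. x \<in> Tm \<Longrightarrow> v x = vm x"
    "isCont vp a" "isCont vm a"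
  shows "vertex_value P Tp Tm v a = (if n \<bullet> (a - xs) > 0 then vp a else vm a)"
proof -
  have "a \<in> closure T" using assms(1) V_closure by blast
  then show ?thesis
    using assms plus[of a] Lim_within_eq[OF at_within_Tp, of a v vp] Lim_within_eq[OF at_within_Tm, of a v vm]
    by (simp add: vertex_value_def)
qed

lemma jump_eq:
  assumes "x \<in> G \<inter> T" "\<And>x. x \<in> Tp \<Longrightarrow> v x = vp x" "\<And>x. x \<in> Tm \<Longrightarrow> v x = vm x"
    "isCont vp x" "isCont vm x"
  shows "jump Tp Tm v x = vp x - vm x"
proof -
  have "x \<in> closure T" using assms(1) closure_subset by blast
  then show ?thesis
    using assms middle[of x] Lim_within_eq[OF at_within_Tp, of x v vp] Lim_within_eq[OF at_within_Tm, of x v vm]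
    by (simp add: jump_def)
qed

text \<open>Agreement is known only on the part of the hyperplane inside \<open>T\<close>. As
  \<open>T\<close> is open, each tangential direction can be scaled to stay in it, so the difference
  of the matrices kills all tangential vectors and has rank at most one.\<close>

lemma affine_parts_jump:
  assumes "\<And>x. x \<in> G \<inter> T \<Longrightarrow> Ap *v x + bp = Am *v x + bm"
  obtains d where "Ap = Am + outer d n" "\<And>x. Ap *v x + bp = Am *v x + bm + (n \<bullet> (x - xs)) *\<^sub>R d"
proof -
  have xs': "(Ap - Am) *v xs = bm - bp"
    using assms[of xs] xs middle[OF xs] by (simp add: matrix_vector_mult_diff_rdistrib algebra_simps)
  have "(Ap - Am) *v v = 0" if v: "n \<bullet> v = 0" for v
  proof -
    obtain e where e: "e > 0" "xs + e *\<^sub>R v \<in> T" by (rule step_in_T)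
    then have "xs + e *\<^sub>R v \<in> G \<inter> T" using middle v by simp
    then have "(Ap - Am) *v (xs + e *\<^sub>R v) = bm - bp"
      using assms[of "xs + e *\<^sub>R v"]
      by (simp del: matrix_vector_right_distrib add: matrix_vector_mult_diff_rdistrib algebra_simps)
    then have "(Ap - Am) *v (e *\<^sub>R v) = 0"
      using xs' by (simp add: matrix_vector_right_distrib)
    then show ?thesis using e(1) by (simp add: matrix_vector_mult_scaleR)
  qed
  then have eq: "Ap - Am = outer ((Ap - Am) *v n) n"
    by (rule matrix_eq_outer[OF unit])
  define d where "d = (Ap - Am) *v n"
  have A: "Ap = Am + outer d n" using eq unfolding d_def by (metis add.commute diff_add_cancel)
  have "outer d n *v xs = bm - bp" using xs' eq d_def by simp
  then have "bp = bm - (n \<bullet> xs) *\<^sub>R d" by (simp add: outer_mult_vec algebra_simps)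
  then have "Ap *v x + bp = Am *v x + bm + (n \<bullet> (x - xs)) *\<^sub>R d" for x
    unfolding A by (simp add: matrix_vector_mult_add_rdistrib outer_mult_vec inner_diff_right algebra_simps)
  with A show thesis by (rule that)
qed

end

section \<open>The correction function\<close>

text \<open>Together with \<open>n\<close> the tangents are \<open>CARD('n)\<close> orthonormal
  vectors, hence a basis, and the coefficient of \<open>n\<close> is zero.\<close>

lemma orthonormal_tangent_expand:
  fixes n a :: "real^'n" and t :: "nat \<Rightarrow> real^'n"
  assumes n: "norm n = 1"
    and t: "\<And>i. i \<in> {1..CARD('n) - 1} \<Longrightarrow> norm (t i) = 1 \<and> t i \<bullet> n = 0"
    and tt: "\<And>i j. i \<in> {1..CARD('n) - 1} \<Longrightarrow> j \<in> {1..CARD('n) - 1} \<Longrightarrow> i \<noteq> j \<Longrightarrow> t i \<bullet> t j = 0"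
    and a: "a \<bullet> n = 0"
  shows "a = (\<Sum>i\<in>{1..CARD('n) - 1}. (a \<bullet> t i) *\<^sub>R t i)"
proof -
  let ?I = "{1..CARD('n) - 1}"
  define B where "B = insert n (t ` ?I)"
  have inj: "inj_on t ?I"
    using t tt by (intro inj_onI) (metis inner_eq_zero_iff norm_zero zero_neq_one)
  have n_notin: "n \<notin> t ` ?I"
    using t n by (metis imageE inner_eq_zero_iff norm_zero zero_neq_one)
  have card: "card B = CARD('n)"
    using n_notin card_image[OF inj] by (simp add: B_def)
  have orth: "pairwise orthogonal B"
    using t tt by (fastforce simp: B_def pairwise_def orthogonal_def inner_commute)
  have norm: "norm v = 1" if "v \<in> B" for v
    using that t n by (auto simp: B_def)
  then have "independent B"
    by (intro pairwise_orthogonal_independent orth) force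
  then have "span B = UNIV"
    using card_ge_dim_independent[of B UNIV] card by auto
  then have "a = (\<Sum>v\<in>B. (a \<bullet> v) *\<^sub>R v)"
    using orthonormal_basis_expand[OF orth norm] by (simp add: B_def)
  also have "\<dots> = (\<Sum>v\<in>t ` ?I. (a \<bullet> v) *\<^sub>R v)"
    using n_notin a by (simp add: B_def)
  finally show ?thesis unfolding sum.reindex[OF inj] o_def .
qed

lemma stress_affine_mult:
  assumes "jacobian v (at x) = M"
  shows "stress \<mu> v q x *v n = \<mu> *\<^sub>R (M *v n + transpose M *v n) - q x *\<^sub>R n"
  unfolding stress_def assms
  by (simp add: matrix_vector_mult_diff_rdistrib matrix_vector_mult_add_rdistrib scaleR_matrix_vector_assoc[symmetric])

context cut_simplex
begin

lemma correction_function_formula: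
  fixes t :: "nat \<Rightarrow> real^'n"
  assumes \<mu>: "\<mu>p > 0" "\<mu>m > 0"
    and t: "\<And>i. i \<in> {1..CARD('n) - 1} \<Longrightarrow> norm (t i) = 1 \<and> t i \<bullet> n = 0"
    and tt: "\<And>i j. i \<in> {1..CARD('n) - 1} \<Longrightarrow> j \<in> {1..CARD('n) - 1} \<Longrightarrow> i \<noteq> j \<Longrightarrow> t i \<bullet> t j = 0"
    and H: "\<And>x. infdist x H = \<bar>n \<bullet> (x - xs)\<bar>"
    and corr: "correction_function \<mu>p \<mu>m V (G \<inter> T) P M n gavg u p"
    and Iz: "Iz = simplex_interp V (vertex_value P Tp Tm (z_fun Tp))"
    and Iw: "Iw = simplex_interp V (vertex_value P Tp Tm (w_fun H Tp))"
    and x: "x \<in> T - G"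
  shows "u x = (\<Sum>i\<in>{1..CARD('n) - 1}.
            ((t i \<bullet> gavg) * (w_fun H Tp x - Iw x) /
              (\<mu>p * (1 + (\<mu>m / \<mu>p - 1) * (grad Iw x \<bullet> n)))) *\<^sub>R t i)"
    and "p x = (z_fun Tp x - Iz x) * (n \<bullet> gavg)"
proof -
  define L where "L y = n \<bullet> (y - xs)" for y
  have P: "y \<in> P \<longleftrightarrow> L y > 0" if "y \<in> T \<union> V" for y
    using plus[OF that] by (simp add: L_def)
  have Tm_not_P: "y \<notin> P" if "y \<in> Tm" for y
    using that plus[of y] minus[of y] by auto
  have uP1: "\<And>i. P1_on Tp (\<lambda>x. u x $ i)" "\<And>i. P1_on Tm (\<lambda>x. u x $ i)"
    and pP1: "P1_on Tp p" "P1_on Tm p"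
    and vertex: "\<And>a. a \<in> V \<Longrightarrow> vertex_value P Tp Tm u a = 0"
      "\<And>a. a \<in> V \<Longrightarrow> vertex_value P Tp Tm p a = 0"
    and jump_stress: "\<And>x. x \<in> G \<inter> T \<Longrightarrow>
      jump Tp Tm (\<lambda>y. stress (if y \<in> P then \<mu>p else \<mu>m) u p y *v n) x = gavg"
    and jump_u: "\<And>x. x \<in> G \<inter> T \<Longrightarrow> jump Tp Tm u x = 0"
    and jump_div: "\<And>x. x \<in> G \<inter> T \<Longrightarrow> jump Tp Tm (divergence u) x = 0"
    and jump_grad: "\<And>x. x \<in> G \<inter> T \<Longrightarrow> jump Tp Tm (grad p) x = 0"
    using corr[unfolded correction_function_def Let_def] by blast+
  have xsG: "xs \<in> G \<inter> T" using middle[OF xs] xs by simp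
  obtain Ap bp where up: "\<And>x. x \<in> Tp \<Longrightarrow> u x = Ap *v x + bp"
    using P1_on_vector[OF uP1(1)] by blast
  obtain Am bm where um: "\<And>x. x \<in> Tm \<Longrightarrow> u x = Am *v x + bm"
    using P1_on_vector[OF uP1(2)] by blast
  obtain cp \<beta>p where pp: "\<And>x. x \<in> Tp \<Longrightarrow> p x = cp \<bullet> x + \<beta>p"
    using pP1(1) unfolding P1_on_def by blast
  obtain cm \<beta>m where pm: "\<And>x. x \<in> Tm \<Longrightarrow> p x = cm \<bullet> x + \<beta>m"
    using pP1(2) unfolding P1_on_def by blast
  have cont: "isCont (\<lambda>x. A *v x + b) y" for A :: "real^'n^'n" and b y
    by (intro continuous_intros linear_continuous_at matrix_vector_mul_bounded_linear)
  have cont': "isCont (\<lambda>x. c \<bullet> x + \<beta>) y" for c :: "real^'n" and \<beta> y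
    by (intro continuous_intros)
  have jp: "jacobian u (at y) = Ap" if "y \<in> Tp" for y
    by (rule jacobian_affine_on[OF open_Tp that up])
  have jm: "jacobian u (at y) = Am" if "y \<in> Tm" for y
    by (rule jacobian_affine_on[OF open_Tm that um])

  have "Ap *v y + bp = Am *v y + bm" if "y \<in> G \<inter> T" for y
    using jump_eq[OF that up um cont cont] jump_u[OF that] by simp
  from affine_parts_jump[OF this] obtain d where
    Ap: "Ap = Am + outer d n" and up_um: "\<And>x. Ap *v x + bp = Am *v x + bm + L x *\<^sub>R d"
    unfolding L_def by blast
  \<comment> \<open>The trace of the rank-one jump \<open>outer d n\<close> is
    \<open>d \<bullet> n\<close>, so the divergence condition says that \<open>d\<close> is
    tangential.\<close>
  have "jump Tp Tm (divergence u) xs = trace Ap - trace Am"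
    by (rule jump_eq[OF xsG, where vp = "\<lambda>_. trace Ap" and vm = "\<lambda>_. trace Am"])
      (auto simp: divergence_def jp jm)
  then have dn: "d \<bullet> n = 0"
    using jump_div[OF xsG] by (simp add: Ap trace_add trace_outer)
  have "jump Tp Tm (grad p) xs = cp - cm"
    by (rule jump_eq[OF xsG, where vp = "\<lambda>_. cp" and vm = "\<lambda>_. cm"])
      (use grad_affine_on[OF open_Tp _ pp] grad_affine_on[OF open_Tm _ pm] in auto)
  then have cpm: "cp = cm"
    using jump_grad[OF xsG] by simp
  define q where "q = \<beta>p - \<beta>m"

  obtain cz \<beta>z where Iz_eq: "Iz = (\<lambda>x. cz \<bullet> x + \<beta>z)"
    and cz: "\<And>a. a \<in> V \<Longrightarrow> cz \<bullet> a + \<beta>z = vertex_value P Tp Tm (z_fun Tp) a"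
    using simplex_interp_affine[of "vertex_value P Tp Tm (z_fun Tp)"] unfolding Iz by blast
  obtain k \<gamma> where Iw_eq: "Iw = (\<lambda>x. k \<bullet> x + \<gamma>)"
    and k: "\<And>a. a \<in> V \<Longrightarrow> k \<bullet> a + \<gamma> = vertex_value P Tp Tm (w_fun H Tp) a"
    using simplex_interp_affine[of "vertex_value P Tp Tm (w_fun H Tp)"] unfolding Iw by blast
  have cz': "cz \<bullet> a + \<beta>z = (if L a > 0 then -1 else 0)" if a: "a \<in> V" for a
    using cz[OF a] vertex_value_eq[OF a, of "z_fun Tp" "\<lambda>_. -1" "\<lambda>_. 0"] Tm_not_P
    by (auto simp: z_fun_def L_def)
  have w_plus: "w_fun H Tp y = L y" if "y \<in> Tp" for y
    using that P[of y] by (auto simp: w_fun_def H L_def)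
  have w_minus: "w_fun H Tp y = 0" if "y \<in> Tm" for y
    using that Tm_not_P by (auto simp: w_fun_def)
  \<comment> \<open>On the plus side the distance to \<open>H\<close> is \<open>L\<close> itself, so
    the interpolated \<open>w\<close> is the positive part of \<open>L\<close>.\<close>
  have k': "k \<bullet> a + \<gamma> = max 0 (L a)" if a: "a \<in> V" for a
  proof -
    have "isCont L a" unfolding L_def by (intro continuous_intros)
    then show ?thesis
      using k[OF a] vertex_value_eq[OF a w_plus w_minus] by (auto simp: L_def)
  qed

  \<comment> \<open>With equal gradients \<open>p\<close> is its minus polynomial plus
    \<open>q\<close> on the plus side. Vanishing at the vertices makes that polynomial interpolate
    \<open>q\<close> times \<open>z\<close>.\<close>
  have "cp = q *\<^sub>R cz \<and> \<beta>m = q * \<beta>z"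
  proof -
    have "cp \<bullet> a + \<beta>m = (q *\<^sub>R cz) \<bullet> a + q * \<beta>z" if a: "a \<in> V" for a
    proof -
      have "cp \<bullet> a + \<beta>m = (if L a > 0 then - q else 0)"
        using vertex_value_eq[OF a pp pm cont' cont'] vertex(2)[OF a] cpm
        by (auto simp: L_def q_def split: if_splits)
      also have "\<dots> = q * (cz \<bullet> a + \<beta>z)" using cz'[OF a] by simp
      finally show ?thesis by (simp add: algebra_simps)
    qed
    from affine_eqI[OF this] show ?thesis by simp
  qed
  then have p_minus: "cm \<bullet> y + \<beta>m = q * Iz y" for y
    using cpm by (simp add: Iz_eq algebra_simps)
  have u_minus: "Am = outer d (- k)" "\<And>y. Am *v y + bm = - Iw y *\<^sub>R d"
  proof -
    \<comment> \<open>Unisolvence is scalar, so it is applied to each component of the minus part of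
      \<open>u\<close>, which interpolates \<open>- d $ i\<close> times \<open>w\<close>.\<close>
    have row: "Am $ i = - d $ i *\<^sub>R k" "bm $ i = - d $ i * \<gamma>" for i
    proof -
      have "Am $ i \<bullet> a + bm $ i = (- d $ i *\<^sub>R k) \<bullet> a + - d $ i * \<gamma>" if a: "a \<in> V" for a
      proof -
        have "Am *v a + bm = - max 0 (L a) *\<^sub>R d"
          using vertex_value_eq[OF a up um cont cont] vertex(1)[OF a] up_um[of a]
          by (auto simp: L_def eq_neg_iff_add_eq_0 max_def split: if_splits)
        then have "(Am *v a + bm) $ i = (- max 0 (L a) *\<^sub>R d) $ i"
          by (rule arg_cong)
        then have "Am $ i \<bullet> a + bm $ i = - max 0 (L a) * d $ i"
          unfolding vector_add_component vector_scaleR_component matrix_vector_mul_component by simp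
        also have "\<dots> = - d $ i * (k \<bullet> a + \<gamma>)" using k'[OF a] by simp
        finally show ?thesis by (simp add: algebra_simps)
      qed
      from affine_eqI[OF this] show "Am $ i = - d $ i *\<^sub>R k" "bm $ i = - d $ i * \<gamma>" by auto
    qed
    then show "Am = outer d (- k)"
      by (simp add: vec_eq_iff outer_def)
    moreover have "bm = - \<gamma> *\<^sub>R d" using row by (simp add: vec_eq_iff)
    ultimately show "Am *v y + bm = - Iw y *\<^sub>R d" for y
      by (simp add: outer_mult_vec Iw_eq algebra_simps)
  qed

  define \<kappa> where "\<kappa> = k \<bullet> n"
  \<comment> \<open>This is the denominator of the claimed formula with the fraction cleared; as a
    convex combination of the two viscosities it is positive.\<close>
  define D where "D = \<mu>p * (1 - \<kappa>) + \<mu>m * \<kappa>"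
  have "k \<bullet> a + \<gamma> = max 0 (n \<bullet> a + - (n \<bullet> xs))" if "a \<in> V" for a
    using k'[OF that] by (simp add: L_def inner_diff_right)
  from slope_interp_positive_part[OF this] have \<kappa>: "0 \<le> \<kappa>" "\<kappa> \<le> 1"
    by (simp_all add: \<kappa>_def unit)
  have "D > 0"
    using \<mu> \<kappa> unfolding D_def
    by (cases "\<kappa> = 0") (auto intro!: add_nonneg_pos)
  have D_eq: "\<mu>p * (1 + (\<mu>m / \<mu>p - 1) * (grad Iw x \<bullet> n)) = D"
  proof -
    have "grad Iw x = k"
      by (rule grad_affine_on[of UNIV]) (auto simp: Iw_eq)
    then show ?thesis
      using \<mu> by (simp add: D_def \<kappa>_def field_simps)
  qed

  have Ap_eq: "Ap = outer d (n - k)"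
    by (simp add: Ap u_minus(1) outer_def vec_eq_iff algebra_simps)
  have sp: "stress (if y \<in> P then \<mu>p else \<mu>m) u p y *v n =
      \<mu>p *\<^sub>R ((1 - \<kappa>) *\<^sub>R d) - (cm \<bullet> y + \<beta>p) *\<^sub>R n" if "y \<in> Tp" for y
  proof -
    \<comment> \<open>The transpose contributes a multiple of \<open>d \<bullet> n\<close>, which is
      zero.\<close>
    have "Ap *v n + transpose Ap *v n = (1 - \<kappa>) *\<^sub>R d"
      using unit dn
      by (simp add: Ap_eq transpose_outer outer_mult_vec \<kappa>_def inner_diff_left)
    then show ?thesis
      using that pp[OF that] by (simp add: stress_affine_mult[OF jp[OF that]] cpm)
  qed
  have sm: "stress (if y \<in> P then \<mu>p else \<mu>m) u p y *v n =
      \<mu>m *\<^sub>R (- \<kappa> *\<^sub>R d) - (cm \<bullet> y + \<beta>m) *\<^sub>R n" if "y \<in> Tm" for y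
  proof -
    have "Am *v n + transpose Am *v n = - \<kappa> *\<^sub>R d"
      using dn by (simp add: u_minus(1) transpose_outer outer_mult_vec \<kappa>_def)
    then show ?thesis
      using Tm_not_P[OF that] pm[OF that] by (simp add: stress_affine_mult[OF jm[OF that]])
  qed
  \<comment> \<open>Both traces are taken at \<open>xs\<close>, so the common linear part of the
    pressure cancels and only \<open>q\<close> remains.\<close>
  have "gavg = (\<mu>p *\<^sub>R ((1 - \<kappa>) *\<^sub>R d) - (cm \<bullet> xs + \<beta>p) *\<^sub>R n) -
      (\<mu>m *\<^sub>R (- \<kappa> *\<^sub>R d) - (cm \<bullet> xs + \<beta>m) *\<^sub>R n)"
    by (rule jump_stress[OF xsG, symmetric, THEN trans], rule jump_eq[OF xsG sp sm])
      (auto intro!: continuous_intros)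
  also have "\<dots> = D *\<^sub>R d - q *\<^sub>R n"
    by (simp add: D_def q_def algebra_simps)
  finally have gavg: "gavg = D *\<^sub>R d - q *\<^sub>R n" .

  \<comment> \<open>Since \<open>d\<close> is tangential, the normal component of the datum
    determines \<open>q\<close> and the tangential ones determine \<open>d\<close>.\<close>
  have ng: "n \<bullet> gavg = - q"
    using dn by (simp add: gavg inner_diff_right unit inner_commute)
  have tg: "t i \<bullet> gavg = D * (d \<bullet> t i)" if "i \<in> {1..CARD('n) - 1}" for i
    using t[OF that] by (simp add: gavg inner_diff_right inner_commute)
  have side: "x \<in> Tp \<or> x \<in> Tm"
    using x plus[of x] minus[of x] middle[of x] by force
  have "u x = (w_fun H Tp x - Iw x) *\<^sub>R d"
    using side
  proof
    assume x: "x \<in> Tp"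
    show ?thesis
      unfolding up[OF x] up_um u_minus(2) w_plus[OF x] by (simp add: algebra_simps)
  next
    assume x: "x \<in> Tm"
    show ?thesis
      unfolding um[OF x] u_minus(2) w_minus[OF x] by simp
  qed
  also have "norm n = 1"
    using unit by (simp add: norm_eq_1)
  note orthonormal_tangent_expand[OF this t tt dn]
  finally have "u x = (w_fun H Tp x - Iw x) *\<^sub>R (\<Sum>i\<in>{1..CARD('n) - 1}. (d \<bullet> t i) *\<^sub>R t i)" .
  also have "\<dots> = (\<Sum>i\<in>{1..CARD('n) - 1}. ((t i \<bullet> gavg) * (w_fun H Tp x - Iw x) / D) *\<^sub>R t i)"
    unfolding scaleR_sum_right
    using \<open>D > 0\<close> by (intro sum.cong refl) (simp add: tg)
  finally show "u x = (\<Sum>i\<in>{1..CARD('n) - 1}.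
            ((t i \<bullet> gavg) * (w_fun H Tp x - Iw x) /
              (\<mu>p * (1 + (\<mu>m / \<mu>p - 1) * (grad Iw x \<bullet> n)))) *\<^sub>R t i)"
    unfolding D_eq .
  show "p x = (z_fun Tp x - Iz x) * (n \<bullet> gavg)"
    using side pp[of x] pm[of x] p_minus[of x] Tm_not_P[of x] cpm
    by (auto simp: z_fun_def ng q_def algebra_simps)
qed

end

section \<open>The discrete interface on one element\<close>

lemma infdist_hyperplane:
  fixes n x xs :: "'a::real_inner"
  assumes n: "n \<bullet> n = 1"
  shows "infdist x {y. n \<bullet> (y - xs) = 0} = \<bar>n \<bullet> (x - xs)\<bar>"
proof (rule antisym)
  let ?H = "{y. n \<bullet> (y - xs) = 0}"
  let ?y = "x - (n \<bullet> (x - xs)) *\<^sub>R n"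
  have n': "norm n = 1" using n by (simp add: norm_eq_1)
  have "?y \<in> ?H" using n by (simp add: inner_diff_right)
  then have "infdist x ?H \<le> dist x ?y" by (rule infdist_le)
  then show "infdist x ?H \<le> \<bar>n \<bullet> (x - xs)\<bar>" using n' by (simp add: dist_norm)
  have "\<bar>n \<bullet> (x - xs)\<bar> \<le> dist x y" if "y \<in> ?H" for y
  proof -
    have "n \<bullet> (x - xs) = n \<bullet> (x - y)" using that by (simp add: inner_diff_right)
    then show ?thesis using Cauchy_Schwarz_ineq2[of n "x - y"] n' by (simp add: dist_norm)
  qed
  moreover have "?H \<noteq> {}" using \<open>?y \<in> ?H\<close> by blast
  ultimately show "\<bar>n \<bullet> (x - xs)\<bar> \<le> infdist x ?H"
    unfolding infdist_notempty[OF \<open>?H \<noteq> {}\<close>] by (intro cINF_greatest)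
qed

text \<open>The part of \<open>n\<close> orthogonal to \<open>c\<close> is by assumption orthogonal
  to \<open>n\<close> as well, hence to itself. For \<open>c = 0\<close> the quotient defaults to 0
  and the assumption forces \<open>n = 0\<close>.\<close>

lemma parallel_if_orthogonal_complement_subset:
  fixes c n :: "'a::real_inner"
  assumes "\<And>v. c \<bullet> v = 0 \<Longrightarrow> n \<bullet> v = 0"
  obtains \<kappa> where "n = \<kappa> *\<^sub>R c"
proof -
  define \<kappa> where "\<kappa> = (n \<bullet> c) / (c \<bullet> c)"
  have c: "c \<bullet> (n - \<kappa> *\<^sub>R c) = 0"
    by (simp add: \<kappa>_def inner_diff_right inner_commute)
  then have "(n - \<kappa> *\<^sub>R c) \<bullet> (n - \<kappa> *\<^sub>R c) = 0"
    using assms[OF c] by (simp add: inner_diff_left)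
  then show thesis using that[of \<kappa>] by simp
qed

text \<open>The frame knows \<open>H\<close> and \<open>n\<close> only abstractly, whereas the
  subdomains are given by the interpolant \<open>c\<close>, \<beta>. Openness of \<open>T\<close>
  turns the inclusion in \<open>H\<close> into one of orthogonal complements, so \<open>n\<close> is
  parallel to both \<open>c\<close> and \<open>c'\<close>; the sign of the factor is read off at one
  point on the plus side.\<close>

lemma level_set_hyperplane:
  fixes c n xs :: "'a::real_inner"
  assumes T: "open T" "xs \<in> T" and xs: "c \<bullet> xs + \<beta> = 0"
    and sub: "{x \<in> T. c \<bullet> x + \<beta> = 0} \<subseteq> H" and H: "H = {x. c' \<bullet> x = \<beta>'}"
    and unit: "norm n = 1" and normal: "\<And>x y. x \<in> H \<Longrightarrow> y \<in> H \<Longrightarrow> n \<bullet> (x - y) = 0"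
    and up: "s > 0" "c \<bullet> (xs + s *\<^sub>R n) + \<beta> > 0"
  obtains r where "r > 0" "\<And>x. c \<bullet> x + \<beta> = r * (n \<bullet> (x - xs))" "H = {x. n \<bullet> (x - xs) = 0}"
proof -
  have xsH: "c' \<bullet> xs = \<beta>'" using T(2) xs sub H by auto
  have n_c': "n \<bullet> v = 0" if "c' \<bullet> v = 0" for v
    using normal[of "xs + v" xs] xsH that by (simp add: H inner_add_right)
  have c'_c: "c' \<bullet> v = 0" if v: "c \<bullet> v = 0" for v
  proof -
    obtain e where e: "e > 0" "xs + e *\<^sub>R v \<in> T"
      using eventually_happens'[OF trivial_limit_at_right_real eventually_step_in_open[OF T, of v]]
      by blast
    then have "xs + e *\<^sub>R v \<in> H" using sub xs v by (auto simp: inner_add_right)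
    then show ?thesis using H xsH e(1) by (simp add: inner_add_right)
  qed
  obtain \<kappa>' where \<kappa>': "n = \<kappa>' *\<^sub>R c'"
    using parallel_if_orthogonal_complement_subset[of c' n] n_c' by blast
  obtain \<kappa> where \<kappa>: "n = \<kappa> *\<^sub>R c"
    using parallel_if_orthogonal_complement_subset[of c n] n_c' c'_c by blast
  have "n \<noteq> 0" using unit by auto
  then have nz: "\<kappa> \<noteq> 0" "\<kappa>' \<noteq> 0" using \<kappa> \<kappa>' by auto
  then have c: "c = (1 / \<kappa>) *\<^sub>R n" by (simp add: \<kappa>)
  have eq: "c \<bullet> x + \<beta> = (1 / \<kappa>) * (n \<bullet> (x - xs))" for x
  proof -
    have "c \<bullet> x + \<beta> = c \<bullet> (x - xs)" using xs by (simp add: inner_diff_right)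
    then show ?thesis by (simp add: c)
  qed
  have "n \<bullet> n = 1" using unit by (simp add: norm_eq_1)
  then have "s / \<kappa> > 0" using up(2) eq[of "xs + s *\<^sub>R n"] by simp
  then have "1 / \<kappa> > 0" using up(1) by (simp add: zero_less_divide_iff)
  moreover have "H = {x. n \<bullet> (x - xs) = 0}"
    using nz xsH by (auto simp: H \<kappa>' inner_diff_right)
  ultimately show thesis using that[of "1 / \<kappa>"] eq by blast
qed

theorem mainTheorem7:
  fixes a b :: "real^'n" and \<Omega> \<Gamma> \<Omega>m \<Omega>p :: "(real^'n) set"
    and \<F> :: "(real^'n) set set set"
  assumes dim: "CARD('n) = 2 \<or> CARD('n) = 3"
    and domain: "\<Omega> = box a b" "\<Omega> \<noteq> {}"
    and interface: "closed_C2_hypersurface \<Gamma>" "divides_domain \<Gamma> \<Omega> \<Omega>m \<Omega>p"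
    and meshes: "\<forall>\<T>\<in>\<F>. cartesian_mesh a b \<T>" "shape_regular \<F>"
  shows "\<exists>h0>0. \<forall>\<T>\<in>\<F>. mesh_size \<T> < h0 \<longrightarrow>
    (\<forall>(\<mu>p::real) (\<mu>m::real) (g::real^'n \<Rightarrow> real^'n). \<mu>p > 0 \<longrightarrow> \<mu>m > 0 \<longrightarrow> L2_surface \<Gamma> g \<longrightarrow>
      (let d = signed_distance \<Gamma> \<Omega>m;
           \<Omega>hp = discrete_plus \<Omega> \<T> d;
           \<Omega>hm = discrete_minus \<Omega> \<T> d;
           \<Gamma>h = discrete_interface \<Omega> \<T> d
       in
       \<forall>V\<in>\<T>. \<forall>H n t xs u p.
         (let T = element V; Tp = T \<inter> \<Omega>hp; Tm = T \<inter> \<Omega>hm; \<Gamma>T = \<Gamma>h \<inter> T;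
              gavg = surface_avg (\<Gamma> \<inter> local_cube (diameter T) xs n t) g;
              z = z_fun Tp; w = w_fun H Tp;
              Iz = simplex_interp V (vertex_value \<Omega>hp Tp Tm z);
              Iw = simplex_interp V (vertex_value \<Omega>hp Tp Tm w)
          in
          T \<inter> \<Gamma> \<noteq> {} \<longrightarrow> interface_frame \<Gamma>T \<Omega>hp \<Omega>hm H n t \<longrightarrow> xs \<in> \<Gamma>T \<longrightarrow>
          correction_function \<mu>p \<mu>m V \<Gamma>T \<Omega>hp \<Omega>hm n gavg u p \<longrightarrow>
          (\<forall>x \<in> T - \<Gamma>h.
             u x = (\<Sum>i\<in>{1..CARD('n) - 1}.
                      ((t i \<bullet> gavg) * (w x - Iw x) /
                       (\<mu>p * (1 + (\<mu>m / \<mu>p - 1) * (grad Iw x \<bullet> n)))) *\<^sub>R t i) \<and>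
             p x = (z x - Iz x) * (n \<bullet> gavg)))))"
  unfolding Let_def
proof (rule exI[of _ 1], intro conjI ballI allI impI)
  fix \<T> \<mu>p \<mu>m g and V H :: "(real^'n) set" and n t xs u p x
  let ?d = "signed_distance \<Gamma> \<Omega>m"
  let ?P = "discrete_plus \<Omega> \<T> ?d"
  let ?M = "discrete_minus \<Omega> \<T> ?d"
  let ?G = "discrete_interface \<Omega> \<T> ?d"
  let ?T = "element V"
  let ?g = "surface_avg (\<Gamma> \<inter> local_cube (diameter ?T) xs n t) g"
  assume "\<T> \<in> \<F>" and \<mu>: "\<mu>p > (0::real)" "\<mu>m > (0::real)" and V: "V \<in> \<T>"
    and frame: "interface_frame (?G \<inter> ?T) ?P ?M H n t" and xs: "xs \<in> ?G \<inter> ?T"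
    and corr: "correction_function \<mu>p \<mu>m V (?G \<inter> ?T) ?P ?M n ?g u p"
    and x: "x \<in> ?T - ?G"
  have mesh: "cartesian_mesh a b \<T>" using \<open>\<T> \<in> \<F>\<close> meshes(1) by blast
  obtain lo hi S \<pi> where V_kuhn: "V = kuhn_simplex lo hi S \<pi>" and kuhn: "kuhn lo hi \<pi>"
    using mesh_kuhn[OF mesh V] by blast
  obtain c \<beta> where interp: "simplex_interp V ?d = (\<lambda>x. c \<bullet> x + \<beta>)"
    and vertex: "\<And>v. v \<in> V \<Longrightarrow> c \<bullet> v + \<beta> = ?d v"
    using kuhn.simplex_interp_affine[OF kuhn, of S ?d] V_kuhn by blast
  \<comment> \<open>The vertices lie on the boundary of the open element but are needed as well,
    because \<open>vertex_value\<close> asks for their side.\<close>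
  have mesh_interp: "mesh_interp \<T> ?d y = c \<bullet> y + \<beta>" if "y \<in> ?T \<union> V" for y
    using that
  proof
    assume "y \<in> ?T"
    then show ?thesis by (simp add: mesh_interp_element[OF mesh V] interp)
  next
    assume "y \<in> V"
    then show ?thesis by (simp add: mesh_interp_vertex[OF mesh V] vertex)
  qed
  have closure: "y \<in> closure \<Omega>" if "y \<in> ?T \<union> V" for y
  proof -
    have "?T \<union> V \<subseteq> convex hull V"
      unfolding element_def by (rule Un_least[OF interior_subset hull_subset])
    moreover have "closure \<Omega> = cbox a b"
      using domain(2) closure_box[of a b] unfolding domain(1) by simp
    ultimately show ?thesis
      using mesh_subset_cbox[OF mesh V] that by blast
  qed
  have P: "y \<in> ?P \<longleftrightarrow> c \<bullet> y + \<beta> > 0" and M: "y \<in> ?M \<longleftrightarrow> c \<bullet> y + \<beta> < 0"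
    and G: "y \<in> ?G \<longleftrightarrow> c \<bullet> y + \<beta> = 0" if "y \<in> ?T \<union> V" for y
    using mesh_interp[OF that] closure[OF that]
    by (auto simp: discrete_plus_def discrete_minus_def discrete_interface_def)
  have open_T: "open ?T" by (simp add: element_def)
  note frame' = frame[unfolded interface_frame_def]
  obtain c' \<beta>' where H: "H = {x. c' \<bullet> x = \<beta>'}"
    using frame' by blast
  have sub: "?G \<inter> ?T \<subseteq> H" and unit: "norm n = 1" and normal: "\<And>x y. x \<in> H \<Longrightarrow> y \<in> H \<Longrightarrow> n \<bullet> (x - y) = 0"
    and side: "\<forall>\<^sub>F s in at_right 0. xs + s *\<^sub>R n \<in> ?P \<and> xs - s *\<^sub>R n \<in> ?M"
    and t: "\<And>i. i \<in> {1..CARD('n) - 1} \<Longrightarrow> norm (t i) = 1 \<and> t i \<bullet> n = 0"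
    and tt: "\<And>i j. i \<in> {1..CARD('n) - 1} \<Longrightarrow> j \<in> {1..CARD('n) - 1} \<Longrightarrow> i \<noteq> j \<Longrightarrow> t i \<bullet> t j = 0"
    using frame' xs by blast+
  \<comment> \<open>The point must stay in the element, where membership in the plus domain is the
    sign of \<open>c \<bullet> y + \<beta>\<close>; this fixes the orientation of
    \<open>n\<close>.\<close>
  have "\<forall>\<^sub>F s in at_right 0. s > 0 \<and> xs + s *\<^sub>R n \<in> ?T \<and> xs + s *\<^sub>R n \<in> ?P"
    using side eventually_step_in_open[OF open_T, of xs n] xs
    by (auto elim: eventually_elim2)
  then obtain s where s: "s > 0" "xs + s *\<^sub>R n \<in> ?T" "xs + s *\<^sub>R n \<in> ?P"
    using eventually_happens'[OF trivial_limit_at_right_real] by blast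
  obtain r where r: "r > 0" "\<And>y. c \<bullet> y + \<beta> = r * (n \<bullet> (y - xs))" and H_eq: "H = {x. n \<bullet> (x - xs) = 0}"
  proof (rule level_set_hyperplane[OF open_T _ _ _ H unit normal s(1)])
    show "{x \<in> ?T. c \<bullet> x + \<beta> = 0} \<subseteq> H" using G sub by auto
    show "c \<bullet> (xs + s *\<^sub>R n) + \<beta> > 0" using P s by auto
  qed (use xs G in auto)
  have nn: "n \<bullet> n = 1" using unit by (simp add: norm_eq_1)
  \<comment> \<open>Because \<open>r > 0\<close>, the interpolant and the normalised level
    \<open>n \<bullet> (y - xs)\<close> have the same sign.\<close>
  have "cut_simplex_axioms lo hi S \<pi> n xs ?P ?M ?G"
    unfolding cut_simplex_axioms_def V_kuhn[symmetric]
    using xs nn P M G r by (auto simp: zero_less_mult_iff mult_less_0_iff)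
  note cut = cut_simplex.intro[OF kuhn this]
  have dist_H: "infdist y H = \<bar>n \<bullet> (y - xs)\<bar>" for y
    unfolding H_eq by (rule infdist_hyperplane[OF nn])
  note formula = cut_simplex.correction_function_formula[OF cut, folded V_kuhn, OF \<mu> t tt dist_H corr refl refl x]
  show "u x = (\<Sum>i\<in>{1..CARD('n) - 1}.
          ((t i \<bullet> ?g) * (w_fun H (?T \<inter> ?P) x -
              simplex_interp V (vertex_value ?P (?T \<inter> ?P) (?T \<inter> ?M) (w_fun H (?T \<inter> ?P))) x) /
           (\<mu>p * (1 + (\<mu>m / \<mu>p - 1) *
              (grad (simplex_interp V (vertex_value ?P (?T \<inter> ?P) (?T \<inter> ?M) (w_fun H (?T \<inter> ?P)))) x \<bullet> n)))) *\<^sub>R t i)"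
    by (rule formula(1))
  show "p x = (z_fun (?T \<inter> ?P) x -
        simplex_interp V (vertex_value ?P (?T \<inter> ?P) (?T \<inter> ?M) (z_fun (?T \<inter> ?P))) x) * (n \<bullet> ?g)"
    by (rule formula(2))
qed simp

end
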